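(* Let $E$ be any set and let $I\subseteq\mathcal{C}^\infty(\mathbb{R}^E)$ be an ideal such that $A=\mathcal{C}^\infty(\mathbb{R}^E)/I$ is a $\mathcal{C}^\infty$-reduced $\mathcal{C}^\infty$-ring. Then for all $f,g\in\mathcal{C}^\infty(\mathbb{R}^E)$: $$f+I\prec_A g+I\iff(\exists\varphi\in I)(\forall x\in Z(\varphi))(f(x)<g(x)).$$
   Context: A $\mathcal{C}^\infty$-ring is a set $A$ together with an operation $f^A:A^n\to A$ for every $n\in\mathbb{N}$ and every smooth $f:\mathbb{R}^n\to\mathbb{R}$, such that coordinate projections are interpreted as projections and $f=h\circ(g_1,\dots,g_n)$ implies $f^A=h^A\circ(g_1^A,\dots,g_n^A)$. Homomorphisms are maps commuting with all these operations. A $\mathcal{C}^\infty$-ring has an underlying commutative unital ring (an $\mathbb{R}$-algebra); ideals are ring-theoretic ideals, and for an ideal $I$ the quotient ring $A/I$ inherits a $\mathcal{C}^\infty$-ring structure. $A^\times$ denotes the group of invertible elements. For a set $E$, $\mathcal{C}^\infty(\mathbb{R}^E)$ is the $\mathcal{C}^\infty$-ring of functions $f:\mathbb{R}^E\to\mathbb{R}$ of the form $f=f'\circ\pi_{EE'}$ for some finite $E'\subseteq E$ and some smooth $f':\mathbb{R}^{E'}\to\mathbb{R}$, where $\pi_{EE'}:\mathbb{R}^E\to\mathbb{R}^{E'}$ is restriction. For $\varphi\in\mathcal{C}^\infty(\mathbb{R}^E)$, $Z(\varphi)=\{x\in\mathbb{R}^E:\varphi(x)=0\}$. For a $\mathcal{C}^\infty$-ring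 $A$ and $a\in A$, $\eta_a:A\to A\{a^{-1}\}$ is the universal $\mathcal{C}^\infty$-homomorphism out of $A$ sending $a$ to an invertible element. The $\mathcal{C}^\infty$-radical of an ideal $I\subseteq A$ is $\sqrt[\infty]{I}=\{a\in A: (A/I)\{(a+I)^{-1}\}\cong 0\}$. $A$ is $\mathcal{C}^\infty$-reduced if $\sqrt[\infty]{(0)}=(0)$; $A/I$ is $\mathcal{C}^\infty$-reduced iff $\sqrt[\infty]{I}=I$. The canonical relation on a $\mathcal{C}^\infty$-ring $A$ is: $a\prec_A b$ iff there exists $u\in A^\times$ with $b-a=u^2$. *)

theory Defs
  imports "HOL-Analysis.Analysis" "HOL-Algebra.QuotRing"
begin

section \<open>Smooth functions of finitely many variables\<close>

text \<open>
  Points of the space of real tuples indexed by a set \<open>S\<close> are represented by the extensional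
  functions on \<open>S\<close>; finite Euclidean space of dimension \<open>n\<close> is the case \<open>S = {..<n}\<close>.
  For finite \<open>S\<close> the topology of pointwise convergence on the type of functions induces the
  Euclidean topology on \<open>Rpow S\<close>.  A function on \<open>Rpow S\<close> is smooth if its iterated partial
  derivatives of all orders exist and are continuous; smooth functions are taken to be extensional
  on \<open>Rpow S\<close>, so that equality of functions on \<open>Rpow S\<close> is HOL equality.
\<close>

definition Rpow :: "'i set \<Rightarrow> ('i \<Rightarrow> real) set"
  where "Rpow S = S \<rightarrow>\<^sub>E UNIV"

definition partial_deriv :: "'i \<Rightarrow> (('i \<Rightarrow> real) \<Rightarrow> real) \<Rightarrow> ('i \<Rightarrow> real) \<Rightarrow> real"
  where "partial_deriv i f x = deriv (\<lambda>t. f (x(i := t))) (x i)"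

primrec Ck :: "nat \<Rightarrow> 'i set \<Rightarrow> (('i \<Rightarrow> real) \<Rightarrow> real) \<Rightarrow> bool" where
  "Ck 0 S f \<longleftrightarrow> continuous_on (Rpow S) f"
| "Ck (Suc k) S f \<longleftrightarrow> continuous_on (Rpow S) f \<and>
     (\<forall>i\<in>S. (\<forall>x\<in>Rpow S. (\<lambda>t. f (x(i := t))) differentiable (at (x i))) \<and>
            Ck k S (partial_deriv i f))"

definition smooth_fun :: "'i set \<Rightarrow> (('i \<Rightarrow> real) \<Rightarrow> real) set"
  where "smooth_fun S = {f \<in> Rpow S \<rightarrow>\<^sub>E UNIV. \<forall>k. Ck k S f}"


section \<open>Smooth rings\<close>

text \<open>
  \<open>interp A n f\<close> is the operation of arity \<open>n\<close> given by the smooth function \<open>f\<close> of \<open>n\<close> variables;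
  tuples of length \<open>n\<close> are extensional functions on \<open>{..<n}\<close>.
\<close>

record 'a cinf = "'a partial_object" +
  interp :: "nat \<Rightarrow> ((nat \<Rightarrow> real) \<Rightarrow> real) \<Rightarrow> (nat \<Rightarrow> 'a) \<Rightarrow> 'a"

abbreviation tuples :: "nat \<Rightarrow> 'a set \<Rightarrow> (nat \<Rightarrow> 'a) set"
  where "tuples n X \<equiv> {..<n} \<rightarrow>\<^sub>E X"

abbreviation smooth_op :: "nat \<Rightarrow> ((nat \<Rightarrow> real) \<Rightarrow> real) set"
  where "smooth_op n \<equiv> smooth_fun {..<n}"

locale cinf_ring =
  fixes A :: "'a cinf"
  assumes interp_closed:
      "\<lbrakk>f \<in> smooth_op n; a \<in> tuples n (carrier A)\<rbrakk> \<Longrightarrow> interp A n f a \<in> carrier A"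
    and interp_proj:
      "\<lbrakk>i < n; a \<in> tuples n (carrier A)\<rbrakk> \<Longrightarrow> interp A n (\<lambda>x\<in>Rpow {..<n}. x i) a = a i"
    and interp_comp:
      "\<lbrakk>h \<in> smooth_op n; \<And>i. i < n \<Longrightarrow> g i \<in> smooth_op m; a \<in> tuples m (carrier A)\<rbrakk> \<Longrightarrow>
        interp A m (\<lambda>x\<in>Rpow {..<m}. h (\<lambda>i\<in>{..<n}. g i x)) a =
        interp A n h (\<lambda>i\<in>{..<n}. interp A m (g i) a)"

definition cinf_hom :: "'a cinf \<Rightarrow> 'b cinf \<Rightarrow> ('a \<Rightarrow> 'b) set"
  where "cinf_hom A B = {h \<in> carrier A \<rightarrow> carrier B.
    \<forall>n. \<forall>f\<in>smooth_op n. \<forall>a\<in>tuples n (carrier A).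
      h (interp A n f a) = interp B n f (\<lambda>i\<in>{..<n}. h (a i))}"

text \<open>The underlying ring: its operations are the interpretations of the ring operations of the
  real numbers, which are smooth functions of two, respectively zero, variables.\<close>

definition pair :: "'a \<Rightarrow> 'a \<Rightarrow> nat \<Rightarrow> 'a"
  where "pair a b = (\<lambda>i\<in>{..<2}. if i = 0 then a else b)"

definition ring_of :: "'a cinf \<Rightarrow> 'a ring"
  where "ring_of A =
    \<lparr>carrier = carrier A,
     mult = (\<lambda>a b. interp A 2 (\<lambda>x\<in>Rpow {..<2}. x 0 * x 1) (pair a b)),
     one = interp A 0 (\<lambda>x\<in>Rpow {..<0}. 1) (\<lambda>i\<in>{..<0}. undefined),
     zero = interp A 0 (\<lambda>x\<in>Rpow {..<0}. 0) (\<lambda>i\<in>{..<0}. undefined),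
     add = (\<lambda>a b. interp A 2 (\<lambda>x\<in>Rpow {..<2}. x 0 + x 1) (pair a b))\<rparr>"


section \<open>Free smooth rings, quotients and localizations\<close>

definition cinf_free :: "'e set \<Rightarrow> (('e \<Rightarrow> real) \<Rightarrow> real) cinf"
  where "cinf_free E =
    \<lparr>carrier = {f \<in> Rpow E \<rightarrow>\<^sub>E UNIV.
        \<exists>E' f'. finite E' \<and> E' \<subseteq> E \<and> f' \<in> smooth_fun E' \<and> (\<forall>x\<in>Rpow E. f x = f' (restrict x E'))},
     interp = (\<lambda>n h a. \<lambda>x\<in>Rpow E. h (\<lambda>i\<in>{..<n}. a i x))\<rparr>"

definition cinf_gen :: "'e set \<Rightarrow> 'e \<Rightarrow> ('e \<Rightarrow> real) \<Rightarrow> real"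
  where "cinf_gen E e = (\<lambda>x\<in>Rpow E. x e)"

definition zero_set :: "'e set \<Rightarrow> (('e \<Rightarrow> real) \<Rightarrow> real) \<Rightarrow> ('e \<Rightarrow> real) set"
  where "zero_set E \<phi> = {x \<in> Rpow E. \<phi> x = 0}"

text \<open>
  As in the library's quotient rings, the operations on cosets are defined as the union of the
  cosets of all values on representatives; \<open>interp_quot\<close> below shows that this is the coset of the
  value on any representatives.
\<close>

definition cinf_quot :: "'a cinf \<Rightarrow> 'a set \<Rightarrow> 'a set cinf"
  where "cinf_quot A I =
    \<lparr>carrier = a_rcosets\<^bsub>ring_of A\<^esub> I,
     interp = (\<lambda>n f c. \<Union>a\<in>(\<Pi>\<^sub>E i\<in>{..<n}. c i). I +>\<^bsub>ring_of A\<^esub> interp A n f a)\<rparr>"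

text \<open>
  The localization of \<open>A\<close> at \<open>a\<close> is presented by generators and relations: one generator
  \<open>Some b\<close> for every \<open>b\<close> in \<open>A\<close>, one generator \<open>None\<close> for the inverse of \<open>a\<close>, and the relations
  saying that \<open>b \<mapsto> Some b\<close> is a homomorphism and that \<open>None\<close> is inverse to \<open>Some a\<close>.
  That it is the universal smooth homomorphism out of \<open>A\<close> inverting \<open>a\<close>, against targets in an
  arbitrary type, is proved in \<open>cinf_loc_universal\<close> below.
\<close>

abbreviation loc_vars :: "'a cinf \<Rightarrow> 'a option set"
  where "loc_vars A \<equiv> insert None (Some ` carrier A)"

abbreviation loc_free :: "'a cinf \<Rightarrow> (('a option \<Rightarrow> real) \<Rightarrow> real) cinf"
  where "loc_free A \<equiv> cinf_free (loc_vars A)"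

definition loc_rels :: "'a cinf \<Rightarrow> 'a \<Rightarrow> (('a option \<Rightarrow> real) \<Rightarrow> real) set"
  where "loc_rels A a =
    {cinf_gen (loc_vars A) (Some (interp A n f b)) \<ominus>\<^bsub>ring_of (loc_free A)\<^esub>
       interp (loc_free A) n f (\<lambda>i\<in>{..<n}. cinf_gen (loc_vars A) (Some (b i)))
     | n f b. f \<in> smooth_op n \<and> b \<in> tuples n (carrier A)} \<union>
    {cinf_gen (loc_vars A) (Some a) \<otimes>\<^bsub>ring_of (loc_free A)\<^esub> cinf_gen (loc_vars A) None
       \<ominus>\<^bsub>ring_of (loc_free A)\<^esub> \<one>\<^bsub>ring_of (loc_free A)\<^esub>}"

abbreviation loc_ideal :: "'a cinf \<Rightarrow> 'a \<Rightarrow> (('a option \<Rightarrow> real) \<Rightarrow> real) set"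
  where "loc_ideal A a \<equiv> Idl\<^bsub>ring_of (loc_free A)\<^esub> (loc_rels A a)"

definition cinf_loc :: "'a cinf \<Rightarrow> 'a \<Rightarrow> (('a option \<Rightarrow> real) \<Rightarrow> real) set cinf"
  where "cinf_loc A a = cinf_quot (loc_free A) (loc_ideal A a)"

definition loc_map :: "'a cinf \<Rightarrow> 'a \<Rightarrow> 'a \<Rightarrow> (('a option \<Rightarrow> real) \<Rightarrow> real) set"
  where "loc_map A a b = loc_ideal A a +>\<^bsub>ring_of (loc_free A)\<^esub> cinf_gen (loc_vars A) (Some b)"


section \<open>The smooth radical, reduced rings and the canonical relation\<close>

text \<open>A smooth ring is isomorphic to the zero ring iff zero is its only element.\<close>

definition cinf_radical :: "'a cinf \<Rightarrow> 'a set \<Rightarrow> 'a set"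
  where "cinf_radical A I = {a \<in> carrier A.
    let L = cinf_loc (cinf_quot A I) (I +>\<^bsub>ring_of A\<^esub> a)
    in carrier L = {\<zero>\<^bsub>ring_of L\<^esub>}}"

definition cinf_reduced :: "'a cinf \<Rightarrow> bool"
  where "cinf_reduced A \<longleftrightarrow> cinf_radical A {\<zero>\<^bsub>ring_of A\<^esub>} = {\<zero>\<^bsub>ring_of A\<^esub>}"

definition canon_rel :: "'a cinf \<Rightarrow> 'a \<Rightarrow> 'a \<Rightarrow> bool"
  where "canon_rel A a b \<longleftrightarrow>
    (\<exists>u\<in>Units (ring_of A). b \<ominus>\<^bsub>ring_of A\<^esub> a = u [^]\<^bsub>ring_of A\<^esub> (2::nat))"

section \<open>Calculus of smooth functions\<close>

lemma Rpow_update: "x \<in> Rpow S \<Longrightarrow> i \<in> S \<Longrightarrow> x(i := t) \<in> Rpow S"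
  by (auto simp: Rpow_def PiE_def extensional_def)

lemma Rpow_restrict: "(\<lambda>i\<in>S. g i) \<in> Rpow S"
  by (auto simp: Rpow_def)

lemma partial_deriv_cong:
  assumes "\<And>x. x \<in> Rpow S \<Longrightarrow> f x = g x" "x \<in> Rpow S" "i \<in> S"
  shows "partial_deriv i f x = partial_deriv i g x"
proof -
  have "(\<lambda>t. f (x(i := t))) = (\<lambda>t. g (x(i := t)))"
    using assms Rpow_update by metis
  then show ?thesis by (simp add: partial_deriv_def)
qed

lemma Ck_cong_imp:
  assumes "\<And>x. x \<in> Rpow S \<Longrightarrow> f x = g x" "Ck k S f"
  shows "Ck k S g"
  using assms
proof (induction k arbitrary: f g)
  case 0
  then show ?case by (simp cong: continuous_on_cong)
next
  case (Suc k)
  have eq: "(\<lambda>t. f (x(i := t))) = (\<lambda>t. g (x(i := t)))" if "x \<in> Rpow S" "i \<in> S" for x i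
    using Suc.prems(1) Rpow_update that by metis
  have 1: "continuous_on (Rpow S) g"
    using Suc.prems by (simp cong: continuous_on_cong)
  have 2: "(\<lambda>t. g (x(i := t))) differentiable (at (x i))" if "x \<in> Rpow S" "i \<in> S" for x i
  proof -
    have "(\<lambda>t. f (x(i := t))) differentiable (at (x i))"
      using Suc.prems(2) that by auto
    then show ?thesis by (simp only: eq[OF that])
  qed
  have 3: "Ck k S (partial_deriv i g)" if "i \<in> S" for i
    by (rule Suc.IH[of "partial_deriv i f"])
      (use Suc.prems(2) that partial_deriv_cong[of S f g, OF Suc.prems(1)] in auto)
  show ?case using 1 2 3 by simp
qed

lemma Ck_cong:
  assumes "\<And>x. x \<in> Rpow S \<Longrightarrow> f x = g x"
  shows "Ck k S f \<longleftrightarrow> Ck k S g"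
  using Ck_cong_imp[of S f g k] Ck_cong_imp[of S g f k] assms by metis

lemma Ck_continuous: "Ck k S f \<Longrightarrow> continuous_on (Rpow S) f"
  by (cases k) auto

lemma Ck_SucD: "Ck (Suc k) S f \<Longrightarrow> Ck k S f"
proof (induction k arbitrary: f)
  case (Suc k)
  have "Ck k S (partial_deriv i f)" if "i \<in> S" for i
    using Suc that by auto
  then show ?case using Suc.prems by simp
qed auto

lemma Ck_partial_deriv: "Ck (Suc k) S f \<Longrightarrow> i \<in> S \<Longrightarrow> Ck k S (partial_deriv i f)"
  by simp

lemma Ck_has_partial:
  assumes "Ck (Suc k) S f" "i \<in> S" "x \<in> Rpow S"
  shows "((\<lambda>t. f (x(i := t))) has_real_derivative partial_deriv i f (x(i := s))) (at s)"
proof -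
  have "(\<lambda>t. f ((x(i := s))(i := t))) differentiable (at ((x(i := s)) i))"
    using assms Rpow_update[OF assms(3,2), of s] by (metis Ck.simps(2))
  then have "(\<lambda>t. f (x(i := t))) field_differentiable (at s)"
    by (simp add: field_differentiable_def real_differentiable_def)
  then show ?thesis
    by (simp add: partial_deriv_def field_differentiable_derivI)
qed

lemma Ck_has_partial0:
  assumes "Ck (Suc k) S f" "i \<in> S" "x \<in> Rpow S"
  shows "((\<lambda>t. f (x(i := t))) has_real_derivative partial_deriv i f x) (at (x i))"
  using Ck_has_partial[OF assms, of "x i"] unfolding fun_upd_triv .

lemma Ck_SucI:
  assumes "continuous_on (Rpow S) f"
    and "\<And>i x. i \<in> S \<Longrightarrow> x \<in> Rpow S \<Longrightarrow> ((\<lambda>t. f (x(i := t))) has_real_derivative D i x) (at (x i))"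
    and "\<And>i. i \<in> S \<Longrightarrow> Ck k S (D i)"
  shows "Ck (Suc k) S f"
proof -
  have "partial_deriv i f x = D i x" if "i \<in> S" "x \<in> Rpow S" for i x
    using assms(2)[OF that] by (simp add: partial_deriv_def DERIV_imp_deriv)
  then have "Ck k S (partial_deriv i f)" if "i \<in> S" for i
    using Ck_cong_imp[of S "D i" "partial_deriv i f" k] assms(3) that by metis
  then show ?thesis using assms(1,2)
    by (auto simp: real_differentiable_def)
qed

lemma Ck_const: "Ck k S (\<lambda>_. c)"
proof (induction k arbitrary: c)
  case (Suc k)
  show ?case by (rule Ck_SucI[where D = "\<lambda>_ _. 0"]) (use Suc in auto)
qed auto

lemma Ck_coord: "Ck k S (\<lambda>x. x j)"
proof (cases k)
  case 0
  then show ?thesis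
    using continuous_on_product_then_coordinatewise[OF continuous_on_id] by auto
next
  case (Suc k')
  show ?thesis unfolding Suc
  proof (rule Ck_SucI[where D = "\<lambda>i _. if i = j then 1 else 0"])
    show "Ck k' S (\<lambda>_. if i = j then 1 else 0)" for i
      by (rule Ck_const)
    show "((\<lambda>t. (x(i := t)) j) has_real_derivative (if i = j then 1 else 0)) (at (x i))" for i and x :: "'a \<Rightarrow> real"
      by (cases "i = j") auto
    show "continuous_on (Rpow S) (\<lambda>x. x j)"
      by (rule continuous_on_product_then_coordinatewise[OF continuous_on_id])
  qed
qed

lemma Ck_add:
  assumes "Ck k S f" "Ck k S g"
  shows "Ck k S (\<lambda>x. f x + g x)"
  using assms
proof (induction k arbitrary: f g)
  case 0
  then show ?case by (auto intro!: continuous_intros)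
next
  case (Suc k)
  show ?case
  proof (rule Ck_SucI[where D = "\<lambda>i x. partial_deriv i f x + partial_deriv i g x"])
    show "continuous_on (Rpow S) (\<lambda>x. f x + g x)"
      using Suc.prems by (auto intro!: continuous_intros)
    show "Ck k S (\<lambda>x. partial_deriv i f x + partial_deriv i g x)" if "i \<in> S" for i
      using Suc that by auto
    show "((\<lambda>t. f (x(i := t)) + g (x(i := t))) has_real_derivative
          partial_deriv i f x + partial_deriv i g x) (at (x i))" if "i \<in> S" "x \<in> Rpow S" for i x
      using DERIV_add[OF Ck_has_partial0[OF Suc.prems(1) that] Ck_has_partial0[OF Suc.prems(2) that]] .
  qed
qed

lemma Ck_mult:
  assumes "Ck k S f" "Ck k S g"
  shows "Ck k S (\<lambda>x. f x * g x)"
  using assms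
proof (induction k arbitrary: f g)
  case 0
  then show ?case by (auto intro!: continuous_intros)
next
  case (Suc k)
  show ?case
  proof (rule Ck_SucI[where D = "\<lambda>i x. f x * partial_deriv i g x + partial_deriv i f x * g x"])
    show "continuous_on (Rpow S) (\<lambda>x. f x * g x)"
      using Suc.prems by (auto intro!: continuous_intros)
    show "Ck k S (\<lambda>x. f x * partial_deriv i g x + partial_deriv i f x * g x)" if "i \<in> S" for i
      by (intro Ck_add Suc.IH Ck_partial_deriv[OF Suc.prems(1) that] Ck_partial_deriv[OF Suc.prems(2) that]
          Ck_SucD[OF Suc.prems(1)] Ck_SucD[OF Suc.prems(2)])
    show "((\<lambda>t. f (x(i := t)) * g (x(i := t))) has_real_derivative
          f x * partial_deriv i g x + partial_deriv i f x * g x) (at (x i))" if "i \<in> S" "x \<in> Rpow S" for i x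
      using DERIV_mult'[OF Ck_has_partial0[OF Suc.prems(1) that] Ck_has_partial0[OF Suc.prems(2) that]]
      unfolding fun_upd_triv .
  qed
qed

lemma Ck_sum:
  assumes "\<And>j. j \<in> J \<Longrightarrow> Ck k S (f j)"
  shows "Ck k S (\<lambda>x. \<Sum>j\<in>J. f j x)"
  using assms
  by (induction J rule: infinite_finite_induct) (auto intro: Ck_const Ck_add)

lemma Ck_diff:
  assumes "Ck k S f" "Ck k S g"
  shows "Ck k S (\<lambda>x. f x - g x)"
  using Ck_add[OF assms(1) Ck_mult[OF Ck_const[where c = "-1"] assms(2)]] by simp

lemma tendsto_fun_iff:
  fixes l :: "'a \<Rightarrow> 'b::topological_space"
  shows "(g \<longlongrightarrow> l) F \<longleftrightarrow> (\<forall>i. ((\<lambda>t. g t i) \<longlongrightarrow> l i) F)"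
  using limitin_componentwise[where X = "\<lambda>_. euclidean :: 'b topology" and I = UNIV and f = g and l = l and F = F]
  by (simp add: euclidean_product_topology)

lemma chain_rule:
  assumes "finite T" "T \<subseteq> S" and f: "Ck (Suc 0) S f"
    and "\<And>t. \<gamma> t \<in> Rpow S"
    and "\<And>j. j \<in> T \<Longrightarrow> ((\<lambda>t. \<gamma> t j) has_real_derivative d j) (at t0)"
    and "\<And>j t. j \<notin> T \<Longrightarrow> \<gamma> t j = \<gamma> t0 j"
  shows "((\<lambda>t. f (\<gamma> t)) has_real_derivative (\<Sum>j\<in>T. partial_deriv j f (\<gamma> t0) * d j)) (at t0)"
  using assms(1,2,4,5,6)
proof (induction T arbitrary: \<gamma> rule: finite_induct)
  case empty
  have "\<gamma> t = \<gamma> t0" for t using empty(4) by auto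
  then have "(\<lambda>t. f (\<gamma> t)) = (\<lambda>_. f (\<gamma> t0))" by metis
  then show ?case by simp
next
  case (insert j T)
  define \<delta> where "\<delta> t = (\<gamma> t)(j := \<gamma> t0 j)" for t
  have jS: "j \<in> S" using insert by auto
  have \<delta>S: "\<delta> t \<in> Rpow S" for t
    unfolding \<delta>_def by (rule Rpow_update[OF insert.prems(2) jS])
  have \<delta>0: "\<delta> t0 = \<gamma> t0" by (auto simp: \<delta>_def)
  have IH: "((\<lambda>t. f (\<delta> t)) has_real_derivative (\<Sum>i\<in>T. partial_deriv i f (\<delta> t0) * d i)) (at t0)"
  proof (rule insert.IH[OF _ \<delta>S])
    show "T \<subseteq> S" using insert by auto
    fix i assume "i \<in> T"
    then have "i \<noteq> j" using insert by auto
    then show "((\<lambda>t. \<delta> t i) has_real_derivative d i) (at t0)"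
      using insert.prems(3)[of i] \<open>i \<in> T\<close> by (simp add: \<delta>_def)
  next
    fix i t assume "i \<notin> T"
    then show "\<delta> t i = \<delta> t0 i" using insert.prems(4)[of i t] by (auto simp: \<delta>_def)
  qed
  define p where "p = partial_deriv j f"
  have "\<exists>s. min (\<gamma> t0 j) (\<gamma> t j) \<le> s \<and> s \<le> max (\<gamma> t0 j) (\<gamma> t j) \<and>
      f (\<gamma> t) - f (\<delta> t) = p ((\<delta> t)(j := s)) * (\<gamma> t j - \<gamma> t0 j)" for t
  proof -
    have D: "((\<lambda>s. f ((\<delta> t)(j := s))) has_real_derivative p ((\<delta> t)(j := s))) (at s)" for s
      unfolding p_def by (rule Ck_has_partial[OF f jS \<delta>S])
    have e1: "(\<delta> t)(j := \<gamma> t j) = \<gamma> t" and e2: "(\<delta> t)(j := \<gamma> t0 j) = \<delta> t"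
      by (auto simp: \<delta>_def)
    consider "\<gamma> t0 j < \<gamma> t j" | "\<gamma> t0 j = \<gamma> t j" | "\<gamma> t j < \<gamma> t0 j" by linarith
    then show ?thesis
    proof cases
      case 1
      from MVT2[OF 1, of "\<lambda>s. f ((\<delta> t)(j := s))" "\<lambda>s. p ((\<delta> t)(j := s))"] D
      obtain s where "\<gamma> t0 j < s" "s < \<gamma> t j"
        "f (\<gamma> t) - f (\<delta> t) = (\<gamma> t j - \<gamma> t0 j) * p ((\<delta> t)(j := s))"
        unfolding e1 e2 by auto
      then show ?thesis by (intro exI[of _ s]) (auto simp: mult.commute)
    next
      case 2
      then show ?thesis using e1 e2 by (intro exI[of _ "\<gamma> t j"]) auto
    next
      case 3
      from MVT2[OF 3, of "\<lambda>s. f ((\<delta> t)(j := s))" "\<lambda>s. p ((\<delta> t)(j := s))"] D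
      obtain s where "\<gamma> t j < s" "s < \<gamma> t0 j"
        "f (\<delta> t) - f (\<gamma> t) = (\<gamma> t0 j - \<gamma> t j) * p ((\<delta> t)(j := s))"
        unfolding e1 e2 by auto
      then show ?thesis by (intro exI[of _ s]) (auto simp: algebra_simps)
    qed
  qed
  then obtain \<xi> where \<xi>: "\<And>t. min (\<gamma> t0 j) (\<gamma> t j) \<le> \<xi> t" "\<And>t. \<xi> t \<le> max (\<gamma> t0 j) (\<gamma> t j)"
      "\<And>t. f (\<gamma> t) - f (\<delta> t) = p ((\<delta> t)(j := \<xi> t)) * (\<gamma> t j - \<gamma> t0 j)"
    by metis
  have lim\<gamma>: "((\<lambda>t. \<gamma> t i) \<longlongrightarrow> \<gamma> t0 i) (at t0)" for i
  proof (cases "i \<in> insert j T")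
    case True
    from DERIV_isCont[OF insert.prems(3)[OF True]] show ?thesis by (simp add: isCont_def)
  next
    case False
    then have "(\<lambda>t. \<gamma> t i) = (\<lambda>_. \<gamma> t0 i)" by (intro ext insert.prems(4))
    then show ?thesis by simp
  qed
  have lim\<xi>: "(\<xi> \<longlongrightarrow> \<gamma> t0 j) (at t0)"
  proof (rule tendsto_sandwich)
    show "\<forall>\<^sub>F t in at t0. min (\<gamma> t0 j) (\<gamma> t j) \<le> \<xi> t" "\<forall>\<^sub>F t in at t0. \<xi> t \<le> max (\<gamma> t0 j) (\<gamma> t j)"
      using \<xi> by auto
    show "((\<lambda>t. min (\<gamma> t0 j) (\<gamma> t j)) \<longlongrightarrow> \<gamma> t0 j) (at t0)"
      using tendsto_min[OF tendsto_const lim\<gamma>[of j], of "\<gamma> t0 j"] by simp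
    show "((\<lambda>t. max (\<gamma> t0 j) (\<gamma> t j)) \<longlongrightarrow> \<gamma> t0 j) (at t0)"
      using tendsto_max[OF tendsto_const lim\<gamma>[of j], of "\<gamma> t0 j"] by simp
  qed
  have "((\<lambda>t. (\<delta> t)(j := \<xi> t)) \<longlongrightarrow> \<gamma> t0) (at t0)"
    unfolding tendsto_fun_iff
  proof
    fix i show "((\<lambda>t. ((\<delta> t)(j := \<xi> t)) i) \<longlongrightarrow> \<gamma> t0 i) (at t0)"
      using lim\<xi> lim\<gamma>[of i] by (cases "i = j") (auto simp: \<delta>_def)
  qed
  moreover have "continuous_on (Rpow S) p"
    unfolding p_def using f jS by auto
  ultimately have limp: "((\<lambda>t. p ((\<delta> t)(j := \<xi> t))) \<longlongrightarrow> p (\<gamma> t0)) (at t0)"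
    using insert.prems(2) Rpow_update[OF \<delta>S jS] by (intro continuous_on_tendsto_compose[of "Rpow S" p]) auto
  have limd: "((\<lambda>t. (\<gamma> t j - \<gamma> t0 j) / (t - t0)) \<longlongrightarrow> d j) (at t0)"
    using insert.prems(3)[of j] by (simp add: has_field_derivative_iff)
  have "((\<lambda>t. (f (\<gamma> t) - f (\<delta> t) - 0) / (t - t0)) \<longlongrightarrow> p (\<gamma> t0) * d j) (at t0)"
    unfolding \<xi>(3) using tendsto_mult[OF limp limd] by simp
  then have "((\<lambda>t. f (\<gamma> t) - f (\<delta> t)) has_real_derivative p (\<gamma> t0) * d j) (at t0)"
    by (simp add: has_field_derivative_iff \<delta>0)
  from DERIV_add[OF this IH] show ?case
    using insert.hyps by (simp add: \<delta>0 p_def)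
qed

lemma continuous_on_tuple:
  assumes "\<And>j. j \<in> S \<Longrightarrow> continuous_on X (g j)"
  shows "continuous_on X (\<lambda>x. \<lambda>j\<in>S. g j x :: real)"
proof (rule continuous_on_coordinatewise_then_product)
  fix i show "continuous_on X (\<lambda>x. (\<lambda>j\<in>S. g j x) i)"
    using assms by (cases "i \<in> S") auto
qed

lemma continuous_on_comp_tuple:
  assumes "continuous_on (Rpow S) f" "\<And>j. j \<in> S \<Longrightarrow> continuous_on X (g j)"
  shows "continuous_on X (\<lambda>x. f (\<lambda>j\<in>S. g j x))"
  by (rule continuous_on_compose2[OF assms(1) continuous_on_tuple]) (use assms Rpow_restrict in auto)

lemma Ck_comp:
  assumes "finite S" "Ck k S f" "\<And>j. j \<in> S \<Longrightarrow> Ck k T (g j)"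
  shows "Ck k T (\<lambda>x. f (\<lambda>j\<in>S. g j x))"
  using assms(2,3)
proof (induction k arbitrary: f g)
  case 0
  then show ?case
    by (simp only: Ck.simps continuous_on_comp_tuple)
next
  case (Suc k)
  have g': "Ck k T (g j)" if "j \<in> S" for j
    using Suc.prems(2)[OF that] by (rule Ck_SucD)
  show ?case
  proof (rule Ck_SucI[where D = "\<lambda>i x. \<Sum>j\<in>S. partial_deriv j f (\<lambda>j\<in>S. g j x) * partial_deriv i (g j) x"])
    show "continuous_on (Rpow T) (\<lambda>x. f (\<lambda>j\<in>S. g j x))"
      by (rule continuous_on_comp_tuple) (use Suc.prems in auto)
    show "Ck k T (\<lambda>x. \<Sum>j\<in>S. partial_deriv j f (\<lambda>j\<in>S. g j x) * partial_deriv i (g j) x)" if "i \<in> T" for i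
      using that Suc.prems by (intro Ck_sum Ck_mult Suc.IH g') auto
    fix i x assume i: "i \<in> T" and x: "x \<in> Rpow T"
    have f1: "Ck (Suc 0) S f" using Suc.prems(1) Ck_continuous by auto
    have "((\<lambda>t. f (\<lambda>j\<in>S. g j (x(i := t)))) has_real_derivative
        (\<Sum>j\<in>S. partial_deriv j f (\<lambda>j\<in>S. g j (x(i := x i))) * partial_deriv i (g j) x)) (at (x i))"
    proof (rule chain_rule[OF assms(1) subset_refl f1])
      fix j assume "j \<in> S"
      then show "((\<lambda>t. (\<lambda>j\<in>S. g j (x(i := t))) j) has_real_derivative partial_deriv i (g j) x) (at (x i))"
        unfolding restrict_apply'[OF \<open>j \<in> S\<close>] by (rule Ck_has_partial0[OF Suc.prems(2) i x])
    qed (auto simp: Rpow_restrict)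
    then show "((\<lambda>t. f (\<lambda>j\<in>S. g j (x(i := t)))) has_real_derivative
        (\<Sum>j\<in>S. partial_deriv j f (\<lambda>j\<in>S. g j x) * partial_deriv i (g j) x)) (at (x i))"
      by simp
  qed
qed

lemma Ck_integral:
  assumes "p \<notin> T" "Ck k (insert p T) H"
  shows "Ck k T (\<lambda>y. integral {0..1} (\<lambda>t. H (y(p := t))))"
  using assms(2)
proof (induction k arbitrary: H)
  have ins: "y(p := t) \<in> Rpow (insert p T)" if "y \<in> Rpow T" for y t
    using that by (auto simp: Rpow_def PiE_def extensional_def)
  have cont: "continuous_on (Rpow T \<times> X) (\<lambda>(y, t). H (y(p := t)))"
    if "continuous_on (Rpow (insert p T)) H" for H :: "('a \<Rightarrow> real) \<Rightarrow> real" and X :: "real set"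
    unfolding split_def
  proof (rule continuous_on_compose2[OF that])
    show "continuous_on (Rpow T \<times> X) (\<lambda>z. (fst z)(p := snd z))"
    proof (rule continuous_on_coordinatewise_then_product)
      fix i show "continuous_on (Rpow T \<times> X) (\<lambda>z. ((fst z)(p := snd z)) i)"
        using continuous_on_product_then_coordinatewise[OF continuous_on_fst[OF continuous_on_id], of "Rpow T \<times> X" i]
          continuous_on_snd[OF continuous_on_id, of "Rpow T \<times> X"]
        by (cases "i = p") auto
    qed
  qed (use ins in auto)
  have contint: "continuous_on (Rpow T) (\<lambda>y. integral {0..1} (\<lambda>t. H (y(p := t))))"
    if "continuous_on (Rpow (insert p T)) H" for H :: "('a \<Rightarrow> real) \<Rightarrow> real"
    using integral_continuous_on_param[of "Rpow T" 0 1 "\<lambda>y t. H (y(p := t))"] cont[OF that, of "cbox 0 1"]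
    by simp
  {
    case 0
    then show ?case unfolding Ck.simps by (rule contint)
  next
    case (Suc k)
    show ?case
    proof (rule Ck_SucI[where D = "\<lambda>i y. integral {0..1} (\<lambda>t. partial_deriv i H (y(p := t)))"])
      show "continuous_on (Rpow T) (\<lambda>y. integral {0..1} (\<lambda>t. H (y(p := t))))"
        using contint Suc.prems by simp
      show "Ck k T (\<lambda>y. integral {0..1} (\<lambda>t. partial_deriv i H (y(p := t))))" if "i \<in> T" for i
        by (rule Suc.IH) (use Suc.prems that in auto)
      fix i x assume i: "i \<in> T" and x: "x \<in> Rpow T"
      then have ip: "i \<noteq> p" using assms(1) by auto
      have xs: "x(i := s) \<in> Rpow T" for s using Rpow_update[OF x i] .
      have H: "continuous_on (Rpow (insert p T)) H" "continuous_on (Rpow (insert p T)) (partial_deriv i H)"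
        by (rule Ck_continuous[OF Suc.prems], rule Ck_continuous[OF Ck_partial_deriv[OF Suc.prems]], use i in simp)
      have "((\<lambda>s. integral (cbox 0 1) (\<lambda>t. H (x(i := s, p := t)))) has_real_derivative
          integral (cbox 0 1) (\<lambda>t. partial_deriv i H (x(i := x i, p := t)))) (at (x i) within UNIV)"
      proof (rule leibniz_rule_field_derivative)
        fix s t :: real
        have "((\<lambda>s. H ((x(p := t))(i := s))) has_real_derivative partial_deriv i H ((x(p := t))(i := s))) (at s)"
          by (rule Ck_has_partial[OF Suc.prems]) (use i ins[OF x] in auto)
        then show "((\<lambda>s. H (x(i := s, p := t))) has_real_derivative partial_deriv i H (x(i := s, p := t))) (at s within UNIV)"
          using ip by (simp add: fun_upd_twist)
      next
        fix s :: real
        have "continuous_on (cbox 0 1) (\<lambda>t. H (x(i := s, p := t)))"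
        proof (rule continuous_on_compose2[OF H(1)])
          show "continuous_on (cbox 0 1) (\<lambda>t. x(i := s, p := t))"
          proof (rule continuous_on_coordinatewise_then_product)
            fix j show "continuous_on (cbox 0 1) (\<lambda>t. (x(i := s, p := t)) j)"
              by (cases "j = p") (auto intro!: continuous_intros)
          qed
        qed (use ins[OF xs] in auto)
        then show "(\<lambda>t. H (x(i := s, p := t))) integrable_on cbox 0 1"
          by (rule integrable_continuous)
      next
        have "continuous_on (UNIV \<times> cbox 0 1) (\<lambda>z. partial_deriv i H (x(i := fst z, p := snd z)))"
        proof (rule continuous_on_compose2[OF H(2)])
          show "continuous_on (UNIV \<times> cbox 0 1) (\<lambda>z. x(i := fst z, p := snd z))"
          proof (rule continuous_on_coordinatewise_then_product)
            fix j show "continuous_on (UNIV \<times> cbox 0 1) (\<lambda>z. (x(i := fst z, p := snd z)) j)"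
              by (cases "j = p"; cases "j = i") (auto intro!: continuous_intros)
          qed
        qed (use ins[OF xs] in auto)
        then show "continuous_on (UNIV \<times> cbox 0 1) (\<lambda>(s, t). partial_deriv i H (x(i := s, p := t)))"
          by (simp add: split_def)
      qed auto
      then show "((\<lambda>s. integral {0..1} (\<lambda>t. H (x(i := s, p := t)))) has_real_derivative
          integral {0..1} (\<lambda>t. partial_deriv i H (x(p := t)))) (at (x i))"
        by simp
    qed
  }
qed


section \<open>Composition and the one-variable Hadamard lemma\<close>

lemma smooth_funI:
  assumes "\<And>k. Ck k S f"
  shows "(\<lambda>x\<in>Rpow S. f x) \<in> smooth_fun S"
proof -
  have "Ck k S (\<lambda>x\<in>Rpow S. f x)" for k
    by (rule Ck_cong_imp[OF _ assms]) simp
  then show ?thesis by (simp add: smooth_fun_def)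
qed

lemma smooth_fun_Ck: "f \<in> smooth_fun S \<Longrightarrow> Ck k S f"
  by (simp add: smooth_fun_def)

lemma smooth_fun_extensional: "f \<in> smooth_fun S \<Longrightarrow> f \<in> extensional (Rpow S)"
  by (simp add: smooth_fun_def PiE_def)

lemma smooth_fun_eqI:
  assumes "f \<in> smooth_fun S" "g \<in> smooth_fun S" "\<And>x. x \<in> Rpow S \<Longrightarrow> f x = g x"
  shows "f = g"
  using extensionalityI[OF smooth_fun_extensional smooth_fun_extensional] assms by metis

lemma smooth_fun_proj: "(\<lambda>x\<in>Rpow S. x i) \<in> smooth_fun S"
  by (rule smooth_funI[OF Ck_coord])

lemma smooth_fun_const: "(\<lambda>x\<in>Rpow S. c) \<in> smooth_fun S"
  by (rule smooth_funI[OF Ck_const])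

lemma smooth_fun_add:
  assumes "f \<in> smooth_fun S" "g \<in> smooth_fun S"
  shows "(\<lambda>x\<in>Rpow S. f x + g x) \<in> smooth_fun S"
  by (rule smooth_funI[OF Ck_add]) (use assms smooth_fun_Ck in auto)

lemma smooth_fun_mult:
  assumes "f \<in> smooth_fun S" "g \<in> smooth_fun S"
  shows "(\<lambda>x\<in>Rpow S. f x * g x) \<in> smooth_fun S"
  by (rule smooth_funI[OF Ck_mult]) (use assms smooth_fun_Ck in auto)

lemma smooth_fun_comp:
  assumes "finite S" "h \<in> smooth_fun S" "\<And>j. j \<in> S \<Longrightarrow> g j \<in> smooth_fun T"
  shows "(\<lambda>x\<in>Rpow T. h (\<lambda>j\<in>S. g j x)) \<in> smooth_fun T"
  by (rule smooth_funI, rule Ck_comp[OF assms(1)]) (use assms smooth_fun_Ck in blast)+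

lemma hadamard:
  assumes f: "f \<in> smooth_op n" and i: "i < n"
  obtains g where "g \<in> smooth_op (Suc n)"
    "\<And>x s. x \<in> Rpow {..<n} \<Longrightarrow>
       f x - f (x(i := s)) = (x i - s) * g (\<lambda>j\<in>{..<Suc n}. if j < n then x j else s)"
proof -
  define p where "p = Suc n"
  define H where "H z = partial_deriv i f (\<lambda>j\<in>{..<n}. if j = i then z n + z p * (z i - z n) else z j)"
    for z :: "nat \<Rightarrow> real"
  have CH: "Ck k (insert p {..<Suc n}) H" for k
    unfolding H_def
  proof (rule Ck_comp[of "{..<n}" k "partial_deriv i f" _ "\<lambda>j z. if j = i then z n + z p * (z i - z n) else z j"])
    show "Ck k {..<n} (partial_deriv i f)"
      using smooth_fun_Ck[OF f, of "Suc k"] i by simp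
    fix j show "Ck k (insert p {..<Suc n}) (\<lambda>z. if j = i then z n + z p * (z i - z n) else z j)"
      by (cases "j = i") (simp_all only: simp_thms if_True if_False Ck_add Ck_mult Ck_diff Ck_coord)
  qed simp
  define G where "G = (\<lambda>y\<in>Rpow {..<Suc n}. integral {0..1} (\<lambda>t. H (y(p := t))))"
  have "G \<in> smooth_op (Suc n)"
    unfolding G_def by (rule smooth_funI, rule Ck_integral[OF _ CH]) (simp add: p_def)
  moreover have "f x - f (x(i := s)) = (x i - s) * G (\<lambda>j\<in>{..<Suc n}. if j < n then x j else s)"
    if x: "x \<in> Rpow {..<n}" for x s
  proof -
    define y where "y = (\<lambda>j\<in>{..<Suc n}. if j < n then x j else s)"
    have y: "y \<in> Rpow {..<Suc n}" unfolding y_def by (rule Rpow_restrict)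
    have Hy: "H (y(p := t)) = partial_deriv i f (x(i := s + t * (x i - s)))" for t
    proof -
      have "(\<lambda>j\<in>{..<n}. if j = i then (y(p := t)) n + (y(p := t)) p * ((y(p := t)) i - (y(p := t)) n) else (y(p := t)) j)
        = x(i := s + t * (x i - s))"
      proof
        fix j
        show "(\<lambda>j\<in>{..<n}. if j = i then (y(p := t)) n + (y(p := t)) p * ((y(p := t)) i - (y(p := t)) n) else (y(p := t)) j) j
          = (x(i := s + t * (x i - s))) j"
          using x i by (auto simp: y_def p_def Rpow_def PiE_def extensional_def)
      qed
      then show ?thesis by (simp only: H_def)
    qed
    have "((\<lambda>t. f (x(i := s + t * (x i - s)))) has_vector_derivative
        partial_deriv i f (x(i := s + t * (x i - s))) * (x i - s)) (at t within {0..1})" for t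
    proof -
      have 1: "((\<lambda>u. f (x(i := u))) has_real_derivative partial_deriv i f (x(i := s + t * (x i - s)))) (at (s + t * (x i - s)))"
        using Ck_has_partial[OF smooth_fun_Ck[OF f] _ x] i by simp
      have 2: "((\<lambda>t. s + t * (x i - s)) has_real_derivative (x i - s)) (at t within {0..1})"
        by (auto intro!: derivative_eq_intros)
      from DERIV_chain2[OF 1 2] show ?thesis
        by (simp only: has_real_derivative_iff_has_vector_derivative)
    qed
    then have "((\<lambda>t. partial_deriv i f (x(i := s + t * (x i - s))) * (x i - s)) has_integral
        f (x(i := s + 1 * (x i - s))) - f (x(i := s + 0 * (x i - s)))) {0..1}"
      by (intro fundamental_theorem_of_calculus zero_le_one)
    then have "((\<lambda>t. H (y(p := t)) * (x i - s)) has_integral f x - f (x(i := s))) {0..1}"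
      unfolding Hy by simp
    then have "f x - f (x(i := s)) = integral {0..1} (\<lambda>t. H (y(p := t)) * (x i - s))"
      by (rule integral_unique[symmetric])
    also have "\<dots> = (x i - s) * G y"
      using y by (simp add: G_def)
    finally show ?thesis unfolding y_def .
  qed
  ultimately show ?thesis using that by blast
qed


section \<open>Free smooth rings are smooth rings; the underlying ring is a commutative ring\<close>

lemma free_representation_extend:
  assumes "f \<in> smooth_fun E'" "finite E'" "E' \<subseteq> F"
  shows "(\<lambda>x\<in>Rpow F. f (restrict x E')) \<in> smooth_fun F"
proof -
  have "(\<lambda>x\<in>Rpow F. f (\<lambda>j\<in>E'. (\<lambda>x\<in>Rpow F. x j) x)) \<in> smooth_fun F"
    by (rule smooth_fun_comp[OF assms(2,1) smooth_fun_proj])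
  also have "(\<lambda>x\<in>Rpow F. f (\<lambda>j\<in>E'. (\<lambda>x\<in>Rpow F. x j) x)) = (\<lambda>x\<in>Rpow F. f (restrict x E'))"
    by (rule restrict_ext) simp
  finally show ?thesis .
qed

lemma free_common_representation:
  assumes "finite J" "\<forall>j\<in>J. a j \<in> carrier (cinf_free E)"
  shows "\<exists>E' a'. finite E' \<and> E' \<subseteq> E \<and> (\<forall>j\<in>J. a' j \<in> smooth_fun E') \<and>
    (\<forall>j\<in>J. \<forall>x\<in>Rpow E. a j x = a' j (restrict x E'))"
proof -
  have "\<exists>F b. finite F \<and> F \<subseteq> E \<and> b \<in> smooth_fun F \<and> (\<forall>x\<in>Rpow E. a j x = b (restrict x F))" if "j \<in> J" for j
    using assms(2) that by (auto simp: cinf_free_def)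
  then obtain F b where F: "\<And>j. j \<in> J \<Longrightarrow> finite (F j) \<and> F j \<subseteq> E \<and> b j \<in> smooth_fun (F j) \<and> (\<forall>x\<in>Rpow E. a j x = b j (restrict x (F j)))"
    by metis
  define E' where "E' = (\<Union>j\<in>J. F j)"
  define a' where "a' j = (\<lambda>x\<in>Rpow E'. b j (restrict x (F j)))" for j
  show ?thesis
  proof (intro exI conjI ballI)
    show "finite E'" "E' \<subseteq> E" using F assms(1) by (auto simp: E'_def)
    show "a' j \<in> smooth_fun E'" if "j \<in> J" for j
      unfolding a'_def by (rule free_representation_extend) (use F that in \<open>auto simp: E'_def\<close>)
    fix j x assume j: "j \<in> J" and x: "x \<in> Rpow E"
    have "E' \<inter> F j = F j" using j by (auto simp: E'_def)
    moreover have "a j x = b j (restrict x (F j))" using F[OF j] x by blast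
    ultimately show "a j x = a' j (restrict x E')"
      by (simp only: a'_def restrict_apply'[OF Rpow_restrict] restrict_restrict)
  qed
qed

lemma free_carrierI:
  assumes "finite E'" "E' \<subseteq> E" "f' \<in> smooth_fun E'" "\<And>x. x \<in> Rpow E \<Longrightarrow> f x = f' (restrict x E')"
    "f \<in> extensional (Rpow E)"
  shows "f \<in> carrier (cinf_free E)"
proof -
  have "f \<in> Rpow E \<rightarrow>\<^sub>E UNIV" using assms(5) by (simp add: PiE_def)
  then show ?thesis using assms(1-4) unfolding cinf_free_def by auto
qed

lemma free_extensional: "f \<in> carrier (cinf_free E) \<Longrightarrow> f \<in> extensional (Rpow E)"
  by (auto simp: cinf_free_def PiE_def)

lemma free_interp: "interp (cinf_free E) n h a = (\<lambda>x\<in>Rpow E. h (\<lambda>i\<in>{..<n}. a i x))"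
  by (simp add: cinf_free_def)

lemma cinf_ring_free: "cinf_ring (cinf_free E)"
proof
  fix f :: "(nat \<Rightarrow> real) \<Rightarrow> real" and n and a :: "nat \<Rightarrow> ('a \<Rightarrow> real) \<Rightarrow> real"
  assume f: "f \<in> smooth_op n" and a: "a \<in> tuples n (carrier (cinf_free E))"
  have "\<forall>i\<in>{..<n}. a i \<in> carrier (cinf_free E)"
    by (intro ballI PiE_mem[OF a])
  from free_common_representation[of "{..<n}" a E, OF finite_lessThan this]
  obtain E' a' where E': "finite E'" "E' \<subseteq> E" and a': "\<forall>i\<in>{..<n}. a' i \<in> smooth_fun E'"
    "\<forall>i\<in>{..<n}. \<forall>x\<in>Rpow E. a i x = a' i (restrict x E')"
    by (elim exE conjE) (rule that)
  show "interp (cinf_free E) n f a \<in> carrier (cinf_free E)"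
    unfolding free_interp
  proof (rule free_carrierI[OF E'])
    show "(\<lambda>x\<in>Rpow E'. f (\<lambda>i\<in>{..<n}. a' i x)) \<in> smooth_fun E'"
      by (rule smooth_fun_comp[OF _ f]) (use a'(1) in auto)
    fix x assume x: "x \<in> Rpow E"
    have "(\<lambda>i\<in>{..<n}. a i x) = (\<lambda>i\<in>{..<n}. a' i (restrict x E'))"
      by (rule restrict_ext) (use a'(2) x in blast)
    then show "(\<lambda>x\<in>Rpow E. f (\<lambda>i\<in>{..<n}. a i x)) x = (\<lambda>x\<in>Rpow E'. f (\<lambda>i\<in>{..<n}. a' i x)) (restrict x E')"
      using x by (simp only: restrict_apply' Rpow_restrict)
  qed simp
next
  fix i n and a :: "nat \<Rightarrow> ('a \<Rightarrow> real) \<Rightarrow> real"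
  assume i: "i < n" and a: "a \<in> tuples n (carrier (cinf_free E))"
  show "interp (cinf_free E) n (\<lambda>x\<in>Rpow {..<n}. x i) a = a i"
  proof (rule extensionalityI[of _ "Rpow E"])
    show "a i \<in> extensional (Rpow E)" by (rule free_extensional, rule PiE_mem[OF a]) (use i in simp)
    show "interp (cinf_free E) n (\<lambda>x\<in>Rpow {..<n}. x i) a \<in> extensional (Rpow E)"
      unfolding free_interp by simp
    show "interp (cinf_free E) n (\<lambda>x\<in>Rpow {..<n}. x i) a x = a i x" if "x \<in> Rpow E" for x
      using that i by (simp add: free_interp Rpow_def)
  qed
next
  fix h :: "(nat \<Rightarrow> real) \<Rightarrow> real" and n g m and a :: "nat \<Rightarrow> ('a \<Rightarrow> real) \<Rightarrow> real"
  show "interp (cinf_free E) m (\<lambda>x\<in>Rpow {..<m}. h (\<lambda>i\<in>{..<n}. g i x)) a =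
       interp (cinf_free E) n h (\<lambda>i\<in>{..<n}. interp (cinf_free E) m (g i) a)"
    unfolding free_interp
  proof (rule restrict_ext)
    fix x assume x: "x \<in> Rpow E"
    have "(\<lambda>i\<in>{..<n}. (\<lambda>i\<in>{..<n}. \<lambda>x\<in>Rpow E. g i (\<lambda>i\<in>{..<m}. a i x)) i x) = (\<lambda>i\<in>{..<n}. g i (\<lambda>i\<in>{..<m}. a i x))"
      by (rule restrict_ext) (use x in simp)
    then show "(\<lambda>x\<in>Rpow {..<m}. h (\<lambda>i\<in>{..<n}. g i x)) (\<lambda>i\<in>{..<m}. a i x) =
        h (\<lambda>i\<in>{..<n}. (\<lambda>i\<in>{..<n}. \<lambda>x\<in>Rpow E. g i (\<lambda>i\<in>{..<m}. a i x)) i x)"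
      by (simp only: restrict_apply' Rpow_restrict)
  qed
qed

lemma pair_tuple: "a \<in> X \<Longrightarrow> b \<in> X \<Longrightarrow> pair a b \<in> tuples 2 X"
  by (auto simp: pair_def)

lemma ring_of_carrier [simp]: "carrier (ring_of A) = carrier A"
  by (simp add: ring_of_def)

context cinf_ring
begin

lemma interp_op2:
  assumes h: "h \<in> smooth_op 2" and f: "f \<in> smooth_op n" and g: "g \<in> smooth_op n"
    and a: "a \<in> tuples n (carrier A)"
  shows "interp A 2 h (pair (interp A n f a) (interp A n g a)) = interp A n (\<lambda>x\<in>Rpow {..<n}. h (pair (f x) (g x))) a"
proof -
  have "interp A n (\<lambda>x\<in>Rpow {..<n}. h (\<lambda>i\<in>{..<2}. (if i = 0 then f else g) x)) a =
      interp A 2 h (\<lambda>i\<in>{..<2}. interp A n (if i = 0 then f else g) a)"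
    by (rule interp_comp[OF h _ a]) (use f g in auto)
  moreover have "(\<lambda>i\<in>{..<2}. interp A n (if i = 0 then f else g) a) = pair (interp A n f a) (interp A n g a)"
    unfolding pair_def by (rule restrict_ext) simp
  moreover have "(\<lambda>i\<in>{..<2}. (if i = 0 then f else g) x) = pair (f x) (g x)" for x
    unfolding pair_def by (rule restrict_ext) simp
  ultimately show ?thesis by simp
qed

lemma pair_Rpow: "pair (s :: real) t \<in> Rpow {..<2}"
  unfolding pair_def by (rule Rpow_restrict)

lemma pair_simps [simp]: "pair s t 0 = s" "pair s t (Suc 0) = t"
  by (simp_all add: pair_def)

lemma interp_add:
  assumes f: "f \<in> smooth_op n" and g: "g \<in> smooth_op n" and a: "a \<in> tuples n (carrier A)"
  shows "interp A n f a \<oplus>\<^bsub>ring_of A\<^esub> interp A n g a = interp A n (\<lambda>x\<in>Rpow {..<n}. f x + g x) a"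
proof -
  have h: "(\<lambda>x\<in>Rpow {..<2}. x 0 + x 1) \<in> smooth_op 2"
    by (rule smooth_funI) (intro Ck_add Ck_coord)
  show ?thesis
    using interp_op2[OF h f g a] by (simp add: ring_of_def pair_Rpow)
qed

lemma interp_mult:
  assumes f: "f \<in> smooth_op n" and g: "g \<in> smooth_op n" and a: "a \<in> tuples n (carrier A)"
  shows "interp A n f a \<otimes>\<^bsub>ring_of A\<^esub> interp A n g a = interp A n (\<lambda>x\<in>Rpow {..<n}. f x * g x) a"
proof -
  have h: "(\<lambda>x\<in>Rpow {..<2}. x 0 * x 1) \<in> smooth_op 2"
    by (rule smooth_funI) (intro Ck_mult Ck_coord)
  show ?thesis
    using interp_op2[OF h f g a] by (simp add: ring_of_def pair_Rpow)
qed

lemma interp_const: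
  assumes a: "a \<in> tuples n (carrier A)"
  shows "interp A 0 (\<lambda>x\<in>Rpow {..<0}. c) (\<lambda>i\<in>{..<0}. undefined) = interp A n (\<lambda>x\<in>Rpow {..<n}. c) a"
proof -
  have c: "(\<lambda>x\<in>Rpow {..<0::nat}. c) (\<lambda>i\<in>{..<0}. undefined) = c"
    by (rule restrict_apply'[OF Rpow_restrict])
  have e: "(\<lambda>i\<in>{..<0::nat}. interp A n (\<lambda>_. undefined) a) = (\<lambda>i\<in>{..<0}. undefined)"
    by (rule restrict_ext) simp
  have "interp A n (\<lambda>x\<in>Rpow {..<n}. (\<lambda>x\<in>Rpow {..<0::nat}. c) (\<lambda>i\<in>{..<0}. undefined)) a =
      interp A 0 (\<lambda>x\<in>Rpow {..<0}. c) (\<lambda>i\<in>{..<0}. interp A n (\<lambda>_. undefined) a)"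
    by (rule interp_comp[where n = 0 and g = "\<lambda>_ _. undefined", OF smooth_fun_const _ a]) simp
  then show ?thesis by (simp only: c e)
qed

lemma interp_zero: "a \<in> tuples n (carrier A) \<Longrightarrow> \<zero>\<^bsub>ring_of A\<^esub> = interp A n (\<lambda>x\<in>Rpow {..<n}. 0) a"
  using interp_const[of a n 0] by (simp add: ring_of_def)

lemma interp_one: "a \<in> tuples n (carrier A) \<Longrightarrow> \<one>\<^bsub>ring_of A\<^esub> = interp A n (\<lambda>x\<in>Rpow {..<n}. 1) a"
  using interp_const[of a n 1] by (simp add: ring_of_def)

lemma cring_ring_of: "cring (ring_of A)"
proof -
  define P :: "nat \<Rightarrow> (nat \<Rightarrow> real) \<Rightarrow> real" where "P i = (\<lambda>x\<in>Rpow {..<3}. x i)" for i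
  have P: "P i \<in> smooth_op 3" for i unfolding P_def by (rule smooth_fun_proj)
  have rep: "\<exists>t\<in>tuples 3 (carrier A). a = interp A 3 (P 0) t \<and> b = interp A 3 (P 1) t \<and> c = interp A 3 (P 2) t"
    if "a \<in> carrier A" "b \<in> carrier A" "c \<in> carrier A" for a b c
  proof -
    define t where "t = (\<lambda>i\<in>{..<3::nat}. if i = 0 then a else if i = 1 then b else c)"
    have t: "t \<in> tuples 3 (carrier A)" using that by (auto simp: t_def)
    then show ?thesis using interp_proj[OF _ t]
      by (intro bexI[of _ t]) (simp_all add: P_def, simp_all add: t_def)
  qed
  note sm = P smooth_fun_add smooth_fun_mult smooth_fun_const
  have closed: "interp A n f a \<in> carrier A" if "f \<in> smooth_op n" "a \<in> tuples n (carrier A)" for f n a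
    using interp_closed that by blast
  have one: "\<one>\<^bsub>ring_of A\<^esub> \<in> carrier A" "\<zero>\<^bsub>ring_of A\<^esub> \<in> carrier A"
    using interp_closed[of _ 0 "\<lambda>i\<in>{..<0}. undefined"] smooth_fun_const by (auto simp: ring_of_def)
  show ?thesis
  proof (intro cringI abelian_groupI comm_monoidI; (unfold ring_of_carrier)?)
    fix a b c assume abc: "a \<in> carrier A" "b \<in> carrier A" "c \<in> carrier A"
    from rep[OF abc] obtain t where t: "t \<in> tuples 3 (carrier A)"
      and e: "a = interp A 3 (P 0) t" "b = interp A 3 (P 1) t" "c = interp A 3 (P 2) t" by blast
    show "a \<oplus>\<^bsub>ring_of A\<^esub> b \<oplus>\<^bsub>ring_of A\<^esub> c = a \<oplus>\<^bsub>ring_of A\<^esub> (b \<oplus>\<^bsub>ring_of A\<^esub> c)"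
      unfolding e by (simp add: interp_add[OF _ _ t] interp_mult[OF _ _ t] sm, rule arg_cong[of _ _ "\<lambda>f. interp A 3 f t"], rule restrict_ext) (simp add: algebra_simps)
    show "a \<otimes>\<^bsub>ring_of A\<^esub> b \<otimes>\<^bsub>ring_of A\<^esub> c = a \<otimes>\<^bsub>ring_of A\<^esub> (b \<otimes>\<^bsub>ring_of A\<^esub> c)"
      unfolding e by (simp add: interp_add[OF _ _ t] interp_mult[OF _ _ t] sm, rule arg_cong[of _ _ "\<lambda>f. interp A 3 f t"], rule restrict_ext) (simp add: algebra_simps)
    show "(a \<oplus>\<^bsub>ring_of A\<^esub> b) \<otimes>\<^bsub>ring_of A\<^esub> c = a \<otimes>\<^bsub>ring_of A\<^esub> c \<oplus>\<^bsub>ring_of A\<^esub> b \<otimes>\<^bsub>ring_of A\<^esub> c"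
      unfolding e by (simp add: interp_add[OF _ _ t] interp_mult[OF _ _ t] sm, rule arg_cong[of _ _ "\<lambda>f. interp A 3 f t"], rule restrict_ext) (simp add: algebra_simps)
  next
    fix a b assume ab: "a \<in> carrier A" "b \<in> carrier A"
    from rep[OF ab ab(2)] obtain t where t: "t \<in> tuples 3 (carrier A)"
      and e: "a = interp A 3 (P 0) t" "b = interp A 3 (P 1) t" by blast
    show "a \<oplus>\<^bsub>ring_of A\<^esub> b \<in> carrier A" "a \<otimes>\<^bsub>ring_of A\<^esub> b \<in> carrier A"
      unfolding e by (simp_all add: interp_add[OF _ _ t] interp_mult[OF _ _ t] sm closed t)
    show "a \<oplus>\<^bsub>ring_of A\<^esub> b = b \<oplus>\<^bsub>ring_of A\<^esub> a"
      unfolding e by (simp add: interp_add[OF _ _ t] interp_mult[OF _ _ t] sm, rule arg_cong[of _ _ "\<lambda>f. interp A 3 f t"], rule restrict_ext) (simp add: algebra_simps)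
    show "a \<otimes>\<^bsub>ring_of A\<^esub> b = b \<otimes>\<^bsub>ring_of A\<^esub> a"
      unfolding e by (simp add: interp_add[OF _ _ t] interp_mult[OF _ _ t] sm, rule arg_cong[of _ _ "\<lambda>f. interp A 3 f t"], rule restrict_ext) (simp add: algebra_simps)
  next
    fix a assume a: "a \<in> carrier A"
    from rep[OF a a a] obtain t where t: "t \<in> tuples 3 (carrier A)" and e: "a = interp A 3 (P 0) t" by blast
    have P0: "P 0 = (\<lambda>x\<in>Rpow {..<3}. P 0 x)" unfolding P_def by (rule restrict_ext) simp
    show "\<zero>\<^bsub>ring_of A\<^esub> \<oplus>\<^bsub>ring_of A\<^esub> a = a"
      unfolding e interp_zero[OF t]
      by (simp add: interp_add[OF _ _ t] sm, rule arg_cong[of _ _ "\<lambda>f. interp A 3 f t"], subst (2) P0, rule restrict_ext) (simp add: algebra_simps)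
    show "\<one>\<^bsub>ring_of A\<^esub> \<otimes>\<^bsub>ring_of A\<^esub> a = a"
      unfolding e interp_one[OF t]
      by (simp add: interp_mult[OF _ _ t] sm, rule arg_cong[of _ _ "\<lambda>f. interp A 3 f t"], subst (2) P0, rule restrict_ext) (simp add: algebra_simps)
    define m where "m = interp A 3 (\<lambda>x\<in>Rpow {..<3}. (\<lambda>x\<in>Rpow {..<3}. -1) x * P 0 x) t"
    have "m \<oplus>\<^bsub>ring_of A\<^esub> a = \<zero>\<^bsub>ring_of A\<^esub>"
      unfolding e interp_zero[OF t] m_def
      by (simp only: interp_add[OF _ _ t] sm, rule arg_cong[of _ _ "\<lambda>f. interp A 3 f t"], rule restrict_ext) (simp add: algebra_simps)
    moreover have "m \<in> carrier A" unfolding m_def by (rule closed[OF _ t]) (intro sm)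
    ultimately show "\<exists>y\<in>carrier A. y \<oplus>\<^bsub>ring_of A\<^esub> a = \<zero>\<^bsub>ring_of A\<^esub>" by blast
  qed (use one in auto)
qed

end


section \<open>Quotients by ideals are smooth rings\<close>

lemma tuples_update: "a \<in> tuples n X \<Longrightarrow> i < n \<Longrightarrow> b \<in> X \<Longrightarrow> a(i := b) \<in> tuples n X"
  by (auto simp: PiE_iff extensional_def)

context cinf_ring
begin

lemma interp_congruence_step:
  assumes I: "ideal I (ring_of A)" and f: "f \<in> smooth_op n" and i: "i < n"
    and a: "a \<in> tuples n (carrier A)" and d: "d \<in> I" and b: "b \<in> carrier A"
    and ai: "a i = d \<oplus>\<^bsub>ring_of A\<^esub> b"
  shows "\<exists>d'\<in>I. interp A n f a = d' \<oplus>\<^bsub>ring_of A\<^esub> interp A n f (a(i := b))"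
proof -
  interpret R: cring "ring_of A" by (rule cring_ring_of)
  interpret I: ideal I "ring_of A" by fact
  from hadamard[OF f i] obtain g where g: "g \<in> smooth_op (Suc n)" and
    had: "\<And>x s. x \<in> Rpow {..<n} \<Longrightarrow> f x - f (x(i := s)) = (x i - s) * g (\<lambda>j\<in>{..<Suc n}. if j < n then x j else s)"
    by blast
  define w where "w = (\<lambda>j\<in>{..<Suc n}. if j < n then a j else b)"
  have w: "w \<in> tuples (Suc n) (carrier A)"
    unfolding w_def by (rule restrict_PiE_iff[THEN iffD2]) (use PiE_mem[OF a] b in auto)
  define q :: "nat \<Rightarrow> (nat \<Rightarrow> real) \<Rightarrow> real" where "q j = (\<lambda>y\<in>Rpow {..<Suc n}. y j)" for j
  have q: "q j \<in> smooth_op (Suc n)" for j unfolding q_def by (rule smooth_fun_proj)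
  have qw: "interp A (Suc n) (q j) w = (if j < n then a j else b)" if "j < Suc n" for j
    using interp_proj[OF that w] that by (simp add: q_def w_def)
  define F1 where "F1 = (\<lambda>y\<in>Rpow {..<Suc n}. f (\<lambda>j\<in>{..<n}. q j y))"
  define F2 where "F2 = (\<lambda>y\<in>Rpow {..<Suc n}. f (\<lambda>j\<in>{..<n}. (if j = i then q n else q j) y))"
  define D where "D = (\<lambda>y\<in>Rpow {..<Suc n}. y i - y n :: real)"
  have D: "D \<in> smooth_op (Suc n)"
    unfolding D_def by (rule smooth_funI) (intro Ck_diff Ck_coord)
  have F2: "F2 \<in> smooth_op (Suc n)"
    unfolding F2_def by (rule smooth_fun_comp[OF _ f]) (use q in auto)
  have F1w: "interp A (Suc n) F1 w = interp A n f a"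
  proof -
    have "interp A (Suc n) F1 w = interp A n f (\<lambda>j\<in>{..<n}. interp A (Suc n) (q j) w)"
      unfolding F1_def by (rule interp_comp[OF f q w])
    also have "(\<lambda>j\<in>{..<n}. interp A (Suc n) (q j) w) = a"
    proof (rule extensionalityI[of _ "{..<n}"])
      show "a \<in> extensional {..<n}" using a by (simp add: PiE_def)
      show "(\<lambda>j\<in>{..<n}. interp A (Suc n) (q j) w) j = a j" if "j \<in> {..<n}" for j
        using that by (simp add: qw)
    qed simp
    finally show ?thesis .
  qed
  have F2w: "interp A (Suc n) F2 w = interp A n f (a(i := b))"
  proof -
    have "interp A (Suc n) F2 w = interp A n f (\<lambda>j\<in>{..<n}. interp A (Suc n) (if j = i then q n else q j) w)"
      unfolding F2_def by (rule interp_comp[OF f _ w]) (use q in auto)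
    also have "(\<lambda>j\<in>{..<n}. interp A (Suc n) (if j = i then q n else q j) w) = a(i := b)"
    proof (rule extensionalityI[of _ "{..<n}"])
      have "a(i := b) \<in> tuples n (carrier A)" by (rule tuples_update[OF a i b])
      then show "a(i := b) \<in> extensional {..<n}" by (simp only: PiE_def Int_iff)
      show "(\<lambda>j\<in>{..<n}. interp A (Suc n) (if j = i then q n else q j) w) j = (a(i := b)) j" if "j \<in> {..<n}" for j
        using that by (simp add: qw)
    qed simp
    finally show ?thesis .
  qed
  have "interp A (Suc n) D w \<oplus>\<^bsub>ring_of A\<^esub> b = d \<oplus>\<^bsub>ring_of A\<^esub> b"
  proof -
    have "interp A (Suc n) D w \<oplus>\<^bsub>ring_of A\<^esub> interp A (Suc n) (q n) w =
        interp A (Suc n) (\<lambda>y\<in>Rpow {..<Suc n}. D y + q n y) w"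
      by (rule interp_add[OF D q w])
    also have "(\<lambda>y\<in>Rpow {..<Suc n}. D y + q n y) = q i"
      unfolding D_def q_def by (rule restrict_ext) simp
    finally show ?thesis using i ai by (simp add: qw)
  qed
  then have Dw: "interp A (Suc n) D w = d"
    using interp_closed[OF D w] b I.a_Hcarr[OF d] by simp
  have "F1 = (\<lambda>y\<in>Rpow {..<Suc n}. (\<lambda>y\<in>Rpow {..<Suc n}. D y * g y) y + F2 y)"
    unfolding F1_def
  proof (rule restrict_ext)
    fix y assume y: "y \<in> Rpow {..<Suc n}"
    define x where "x = (\<lambda>j\<in>{..<n}. q j y)"
    have e1: "(\<lambda>j\<in>{..<Suc n}. if j < n then x j else y n) = y"
    proof (rule extensionalityI[of _ "{..<Suc n}"])
      show "y \<in> extensional {..<Suc n}" using y by (simp add: Rpow_def PiE_def)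
      show "(\<lambda>j\<in>{..<Suc n}. if j < n then x j else y n) j = y j" if "j \<in> {..<Suc n}" for j
        using that y less_Suc_eq by (auto simp: x_def q_def)
    qed simp
    have e2: "(\<lambda>j\<in>{..<n}. (if j = i then q n else q j) y) = x(i := y n)"
    proof
      fix j show "(\<lambda>j\<in>{..<n}. (if j = i then q n else q j) y) j = (x(i := y n)) j"
        using i y by (simp add: x_def q_def)
    qed
    have x: "x \<in> Rpow {..<n}" unfolding x_def by (rule Rpow_restrict)
    have "x i = y i" using y i by (simp add: x_def q_def)
    then have "f x - f (x(i := y n)) = (y i - y n) * g y"
      using had[OF x, of "y n"] by (simp only: e1)
    then show "f (\<lambda>j\<in>{..<n}. q j y) = (\<lambda>y\<in>Rpow {..<Suc n}. D y * g y) y + F2 y"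
      using y by (simp only: x_def[symmetric] F2_def D_def e2 restrict_apply' algebra_simps)
  qed
  then have "interp A n f a = interp A (Suc n) (\<lambda>y\<in>Rpow {..<Suc n}. (\<lambda>y\<in>Rpow {..<Suc n}. D y * g y) y + F2 y) w"
    by (simp only: F1w[symmetric])
  also have "\<dots> = (d \<otimes>\<^bsub>ring_of A\<^esub> interp A (Suc n) g w) \<oplus>\<^bsub>ring_of A\<^esub> interp A n f (a(i := b))"
    by (simp only: interp_add[OF smooth_fun_mult[OF D g] F2 w, symmetric] interp_mult[OF D g w, symmetric] Dw F2w)
  finally show ?thesis
    using I.I_r_closed[OF d] interp_closed[OF g w] by auto
qed

lemma interp_congruence:
  assumes I: "ideal I (ring_of A)" and f: "f \<in> smooth_op n"
    and a: "a \<in> tuples n (carrier A)" and b: "b \<in> tuples n (carrier A)"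
    and ab: "\<And>i. i < n \<Longrightarrow> a i \<in> I +>\<^bsub>ring_of A\<^esub> b i"
  shows "interp A n f a \<in> I +>\<^bsub>ring_of A\<^esub> interp A n f b"
proof -
  interpret R: cring "ring_of A" by (rule cring_ring_of)
  interpret I: ideal I "ring_of A" by fact
  define c where "c m = (\<lambda>i\<in>{..<n}. if i < m then b i else a i)" for m
  have c: "c m \<in> tuples n (carrier A)" for m
    unfolding c_def by (rule restrict_PiE_iff[THEN iffD2]) (use PiE_mem[OF a] PiE_mem[OF b] in auto)
  have "\<exists>d\<in>I. interp A n f a = d \<oplus>\<^bsub>ring_of A\<^esub> interp A n f (c m)" if "m \<le> n" for m
    using that
  proof (induction m)
    case 0
    have "c 0 = a"
      unfolding c_def by (rule extensionalityI[of _ "{..<n}"]) (use a in \<open>auto simp: PiE_def\<close>)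
    then show ?case
      using interp_closed[OF f a] I.zero_closed by (intro bexI[of _ "\<zero>\<^bsub>ring_of A\<^esub>"]) auto
  next
    case (Suc m)
    then obtain d where d: "d \<in> I" "interp A n f a = d \<oplus>\<^bsub>ring_of A\<^esub> interp A n f (c m)" by auto
    have m: "m < n" using Suc by simp
    have bm: "b m \<in> carrier A" using PiE_mem[OF b] m by simp
    obtain e where e: "e \<in> I" "c m m = e \<oplus>\<^bsub>ring_of A\<^esub> b m"
      using ab[OF m] m by (auto simp: c_def a_r_coset_def r_coset_def)
    have "(c m)(m := b m) = c (Suc m)"
    proof
      fix j show "((c m)(m := b m)) j = c (Suc m) j" using m by (simp add: c_def)
    qed
    then obtain d' where d': "d' \<in> I" "interp A n f (c m) = d' \<oplus>\<^bsub>ring_of A\<^esub> interp A n f (c (Suc m))"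
      using interp_congruence_step[OF I f m c e(1) bm e(2)] by auto
    have "interp A n f a = (d \<oplus>\<^bsub>ring_of A\<^esub> d') \<oplus>\<^bsub>ring_of A\<^esub> interp A n f (c (Suc m))"
      unfolding d(2) d'(2) using I.a_Hcarr[OF d(1)] I.a_Hcarr[OF d'(1)] interp_closed[OF f c, of "Suc m"]
      by (simp add: R.a_assoc)
    then show ?case using d(1) d'(1) by blast
  qed
  from this[of n] obtain d where "d \<in> I" "interp A n f a = d \<oplus>\<^bsub>ring_of A\<^esub> interp A n f (c n)" by auto
  moreover have "c n = b"
    unfolding c_def by (rule extensionalityI[of _ "{..<n}"]) (use b in \<open>auto simp: PiE_def\<close>)
  ultimately show ?thesis by (auto simp: a_r_coset_def r_coset_def)
qed

lemma interp_quot: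
  assumes I: "ideal I (ring_of A)" and f: "f \<in> smooth_op n" and a: "a \<in> tuples n (carrier A)"
  shows "interp (cinf_quot A I) n f (\<lambda>i\<in>{..<n}. I +>\<^bsub>ring_of A\<^esub> a i) = I +>\<^bsub>ring_of A\<^esub> interp A n f a"
proof -
  interpret R: cring "ring_of A" by (rule cring_ring_of)
  interpret I: ideal I "ring_of A" by fact
  have mem: "r \<in> (\<Pi>\<^sub>E i\<in>{..<n}. (\<lambda>i\<in>{..<n}. I +>\<^bsub>ring_of A\<^esub> a i) i) \<longleftrightarrow>
      r \<in> extensional {..<n} \<and> (\<forall>i<n. r i \<in> I +>\<^bsub>ring_of A\<^esub> a i)" for r
    by (auto simp: PiE_iff)
  have "I +>\<^bsub>ring_of A\<^esub> interp A n f r = I +>\<^bsub>ring_of A\<^esub> interp A n f a"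
    if r: "r \<in> extensional {..<n}" "\<forall>i<n. r i \<in> I +>\<^bsub>ring_of A\<^esub> a i" for r
  proof -
    have "r i \<in> carrier A" if i: "i < n" for i
    proof -
      obtain e where "e \<in> I" "r i = e \<oplus>\<^bsub>ring_of A\<^esub> a i"
        using r(2)[rule_format, OF i] by (auto simp: a_r_coset_def r_coset_def)
      then show ?thesis
        using R.a_closed[of e "a i"] I.a_Hcarr[of e] PiE_mem[OF a, of i] that by simp
    qed
    then have "r \<in> tuples n (carrier A)" using r(1) by (auto simp: PiE_iff)
    from interp_congruence[OF I f this a] r(2)
    show ?thesis using R.a_repr_independence[OF _ _ I.a_subgroup, of "interp A n f r" "interp A n f a"] interp_closed[OF f a]
      by simp
  qed
  moreover have "a \<in> extensional {..<n} \<and> (\<forall>i<n. a i \<in> I +>\<^bsub>ring_of A\<^esub> a i)"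
    using a I.a_rcos_self by (auto simp: PiE_iff)
  ultimately have "(\<Union>r\<in>{r. r \<in> extensional {..<n} \<and> (\<forall>i<n. r i \<in> I +>\<^bsub>ring_of A\<^esub> a i)}. I +>\<^bsub>ring_of A\<^esub> interp A n f r)
     = I +>\<^bsub>ring_of A\<^esub> interp A n f a"
    by blast
  moreover have "(\<Pi>\<^sub>E i\<in>{..<n}. (\<lambda>i\<in>{..<n}. I +>\<^bsub>ring_of A\<^esub> a i) i) =
      {r. r \<in> extensional {..<n} \<and> (\<forall>i<n. r i \<in> I +>\<^bsub>ring_of A\<^esub> a i)}"
    using mem by blast
  ultimately show ?thesis by (simp only: cinf_quot_def cinf.simps)
qed

lemma quot_carrier: "carrier (cinf_quot A I) = (\<lambda>a. I +>\<^bsub>ring_of A\<^esub> a) ` carrier A"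
  by (auto simp: cinf_quot_def A_RCOSETS_def RCOSETS_def a_r_coset_def)

lemma quot_tuple_rep:
  assumes "c \<in> tuples n (carrier (cinf_quot A I))"
  obtains a where "a \<in> tuples n (carrier A)" "c = (\<lambda>i\<in>{..<n}. I +>\<^bsub>ring_of A\<^esub> a i)"
proof -
  have "\<exists>x. x \<in> carrier A \<and> c i = I +>\<^bsub>ring_of A\<^esub> x" if "i < n" for i
    using PiE_mem[OF assms, of i] that by (auto simp: quot_carrier)
  then obtain r where r: "\<And>i. i < n \<Longrightarrow> r i \<in> carrier A \<and> c i = I +>\<^bsub>ring_of A\<^esub> r i" by metis
  show ?thesis
  proof
    show "(\<lambda>i\<in>{..<n}. r i) \<in> tuples n (carrier A)" using r by auto
    show "c = (\<lambda>i\<in>{..<n}. I +>\<^bsub>ring_of A\<^esub> (\<lambda>i\<in>{..<n}. r i) i)"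
      by (rule extensionalityI[of _ "{..<n}"]) (use assms r in \<open>auto simp: PiE_def\<close>)
  qed
qed

lemma quot_map_hom:
  assumes I: "ideal I (ring_of A)"
  shows "(\<lambda>a. I +>\<^bsub>ring_of A\<^esub> a) \<in> cinf_hom A (cinf_quot A I)"
  using interp_quot[OF I] by (auto simp: cinf_hom_def quot_carrier)

lemma cinf_ring_quot:
  assumes I: "ideal I (ring_of A)"
  shows "cinf_ring (cinf_quot A I)"
proof
  fix f :: "(nat \<Rightarrow> real) \<Rightarrow> real" and n c
  assume f: "f \<in> smooth_op n" and c: "c \<in> tuples n (carrier (cinf_quot A I))"
  from quot_tuple_rep[OF c] obtain a where a: "a \<in> tuples n (carrier A)" and "c = (\<lambda>i\<in>{..<n}. I +>\<^bsub>ring_of A\<^esub> a i)" .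
  then show "interp (cinf_quot A I) n f c \<in> carrier (cinf_quot A I)"
    using interp_quot[OF I f a] interp_closed[OF f a] by (simp only: quot_carrier) blast
next
  fix i n c
  assume i: "i < n" and c: "c \<in> tuples n (carrier (cinf_quot A I))"
  from quot_tuple_rep[OF c] obtain a where a: "a \<in> tuples n (carrier A)" and ca: "c = (\<lambda>i\<in>{..<n}. I +>\<^bsub>ring_of A\<^esub> a i)" .
  show "interp (cinf_quot A I) n (\<lambda>x\<in>Rpow {..<n}. x i) c = c i"
    unfolding ca interp_quot[OF I smooth_fun_proj a] interp_proj[OF i a] using i by simp
next
  fix h :: "(nat \<Rightarrow> real) \<Rightarrow> real" and n g m c
  assume h: "h \<in> smooth_op n" and g: "\<And>i. i < n \<Longrightarrow> g i \<in> smooth_op m" and c: "c \<in> tuples m (carrier (cinf_quot A I))"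
  from quot_tuple_rep[OF c] obtain a where a: "a \<in> tuples m (carrier A)" and ca: "c = (\<lambda>i\<in>{..<m}. I +>\<^bsub>ring_of A\<^esub> a i)" .
  have hg: "(\<lambda>x\<in>Rpow {..<m}. h (\<lambda>i\<in>{..<n}. g i x)) \<in> smooth_op m"
    by (rule smooth_fun_comp[OF _ h]) (use g in auto)
  have ga: "(\<lambda>i\<in>{..<n}. interp A m (g i) a) \<in> tuples n (carrier A)"
    using interp_closed[OF g a] by auto
  have "interp (cinf_quot A I) m (\<lambda>x\<in>Rpow {..<m}. h (\<lambda>i\<in>{..<n}. g i x)) c
      = I +>\<^bsub>ring_of A\<^esub> interp A n h (\<lambda>i\<in>{..<n}. interp A m (g i) a)"
    unfolding ca interp_quot[OF I hg a] by (simp only: interp_comp[OF h g a])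
  also have "\<dots> = interp (cinf_quot A I) n h (\<lambda>i\<in>{..<n}. I +>\<^bsub>ring_of A\<^esub> (\<lambda>i\<in>{..<n}. interp A m (g i) a) i)"
    by (rule interp_quot[OF I h ga, symmetric])
  also have "(\<lambda>i\<in>{..<n}. I +>\<^bsub>ring_of A\<^esub> (\<lambda>i\<in>{..<n}. interp A m (g i) a) i) =
      (\<lambda>i\<in>{..<n}. interp (cinf_quot A I) m (g i) c)"
    by (rule restrict_ext) (simp add: ca interp_quot[OF I g a])
  finally show "interp (cinf_quot A I) m (\<lambda>x\<in>Rpow {..<m}. h (\<lambda>i\<in>{..<n}. g i x)) c =
      interp (cinf_quot A I) n h (\<lambda>i\<in>{..<n}. interp (cinf_quot A I) m (g i) c)" .
qed

end


section \<open>Homomorphisms; universal properties of free smooth rings and of quotients\<close>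

lemma cinf_homD:
  assumes "h \<in> cinf_hom A B"
  shows "a \<in> carrier A \<Longrightarrow> h a \<in> carrier B"
    and "f \<in> smooth_op n \<Longrightarrow> b \<in> tuples n (carrier A) \<Longrightarrow>
      h (interp A n f b) = interp B n f (\<lambda>i\<in>{..<n}. h (b i))"
  using assms by (auto simp: cinf_hom_def)

lemma cinf_hom_comp:
  assumes "h \<in> cinf_hom A B" "k \<in> cinf_hom B C"
  shows "(\<lambda>a. k (h a)) \<in> cinf_hom A C"
  unfolding cinf_hom_def
proof (intro CollectI conjI allI ballI Pi_I)
  show "k (h a) \<in> carrier C" if "a \<in> carrier A" for a
    using cinf_homD(1)[OF assms(1) that] cinf_homD(1)[OF assms(2)] by blast
  fix n f a assume f: "f \<in> smooth_op n" and a: "a \<in> tuples n (carrier A)"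
  have b: "(\<lambda>i\<in>{..<n}. h (a i)) \<in> tuples n (carrier B)"
    unfolding restrict_PiE_iff using cinf_homD(1)[OF assms(1)] PiE_mem[OF a] by blast
  have "(\<lambda>i\<in>{..<n}. k ((\<lambda>i\<in>{..<n}. h (a i)) i)) = (\<lambda>i\<in>{..<n}. k (h (a i)))"
    by (rule restrict_ext) simp
  then show "k (h (interp A n f a)) = interp C n f (\<lambda>i\<in>{..<n}. k (h (a i)))"
    by (simp only: cinf_homD(2)[OF assms(1) f a] cinf_homD(2)[OF assms(2) f b])
qed

lemma cinf_hom_cong:
  assumes "h \<in> cinf_hom A B" "cinf_ring A" "\<And>a. a \<in> carrier A \<Longrightarrow> k a = h a"
  shows "k \<in> cinf_hom A B"
  unfolding cinf_hom_def
proof (intro CollectI conjI allI ballI Pi_I)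
  show "k a \<in> carrier B" if "a \<in> carrier A" for a
    using cinf_homD(1)[OF assms(1) that] assms(3)[OF that] by simp
  fix n f a assume f: "f \<in> smooth_op n" and a: "a \<in> tuples n (carrier A)"
  have "(\<lambda>i\<in>{..<n}. k (a i)) = (\<lambda>i\<in>{..<n}. h (a i))"
    by (rule restrict_ext) (use assms(3) PiE_mem[OF a] in auto)
  moreover have "k (interp A n f a) = h (interp A n f a)"
    by (rule assms(3), rule cinf_ring.interp_closed[OF assms(2) f a])
  ultimately show "k (interp A n f a) = interp B n f (\<lambda>i\<in>{..<n}. k (a i))"
    by (simp only: cinf_homD(2)[OF assms(1) f a])
qed

lemma cinf_hom_ring_hom:
  assumes "h \<in> cinf_hom A B"
  shows "h \<in> ring_hom (ring_of A) (ring_of B)"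
proof -
  have p: "(\<lambda>i\<in>{..<2}. h (pair a b i)) = pair (h a) (h b)" for a b
    unfolding pair_def by (rule restrict_ext) simp
  have 2: "(\<lambda>x\<in>Rpow {..<2::nat}. x 0 * x 1 :: real) \<in> smooth_op 2" "(\<lambda>x\<in>Rpow {..<2::nat}. x 0 + x 1 :: real) \<in> smooth_op 2"
    by (rule smooth_funI, intro Ck_add Ck_mult Ck_coord)+
  have e: "(\<lambda>i\<in>{..<0}. undefined) \<in> tuples 0 (carrier A)" by simp
  have e': "(\<lambda>i\<in>{..<0::nat}. h ((\<lambda>i\<in>{..<0}. undefined) i)) = (\<lambda>i\<in>{..<0}. undefined)"
    by (rule restrict_ext) simp
  show ?thesis
  proof (rule ring_hom_memI)
    show "h x \<in> carrier (ring_of B)" if "x \<in> carrier (ring_of A)" for x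
      using cinf_homD(1)[OF assms] that by simp
    fix x y assume "x \<in> carrier (ring_of A)" "y \<in> carrier (ring_of A)"
    then have xy: "pair x y \<in> tuples 2 (carrier A)" by (intro pair_tuple) auto
    show "h (x \<otimes>\<^bsub>ring_of A\<^esub> y) = h x \<otimes>\<^bsub>ring_of B\<^esub> h y"
      using cinf_homD(2)[OF assms 2(1) xy] by (simp only: ring_of_def p monoid.simps ring.simps)
    show "h (x \<oplus>\<^bsub>ring_of A\<^esub> y) = h x \<oplus>\<^bsub>ring_of B\<^esub> h y"
      using cinf_homD(2)[OF assms 2(2) xy] by (simp only: ring_of_def p monoid.simps ring.simps)
  next
    show "h \<one>\<^bsub>ring_of A\<^esub> = \<one>\<^bsub>ring_of B\<^esub>"
      using cinf_homD(2)[OF assms smooth_fun_const e, of 1] by (simp only: e' ring_of_def monoid.simps ring.simps)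
  qed
qed

lemma cinf_hom_ring_hom_ring:
  assumes "cinf_ring A" "cinf_ring B" "h \<in> cinf_hom A B"
  shows "ring_hom_ring (ring_of A) (ring_of B) h"
proof -
  interpret A: cring "ring_of A" by (rule cinf_ring.cring_ring_of) fact
  interpret B: cring "ring_of B" by (rule cinf_ring.cring_ring_of) fact
  show ?thesis
    by (rule ring_hom_ringI2[OF A.ring_axioms B.ring_axioms cinf_hom_ring_hom[OF assms(3)]])
qed

definition free_term :: "'e set \<Rightarrow> nat \<Rightarrow> ((nat \<Rightarrow> real) \<Rightarrow> real) \<Rightarrow> (nat \<Rightarrow> 'e) \<Rightarrow> ('e \<Rightarrow> real) \<Rightarrow> real"
  where "free_term E n f q = (\<lambda>x\<in>Rpow E. f (\<lambda>i\<in>{..<n}. x (q i)))"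

lemma gen_closed: "e \<in> E \<Longrightarrow> cinf_gen E e \<in> carrier (cinf_free E)"
  by (rule free_carrierI[of "{e}" E "\<lambda>x\<in>Rpow {e}. x e"])
    (auto simp: cinf_gen_def Rpow_restrict intro: smooth_fun_proj)

lemma free_term_eq: "free_term E n f q = interp (cinf_free E) n f (\<lambda>i\<in>{..<n}. cinf_gen E (q i))"
  unfolding free_term_def free_interp
proof (rule restrict_ext)
  fix x assume "x \<in> Rpow E"
  then have "(\<lambda>i\<in>{..<n}. (\<lambda>i\<in>{..<n}. cinf_gen E (q i)) i x) = (\<lambda>i\<in>{..<n}. x (q i))"
    by (intro restrict_ext) (simp add: cinf_gen_def)
  then show "f (\<lambda>i\<in>{..<n}. x (q i)) = f (\<lambda>i\<in>{..<n}. (\<lambda>i\<in>{..<n}. cinf_gen E (q i)) i x)" by (simp only:)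
qed

lemma gen_tuple: "\<forall>i<n. q i \<in> E \<Longrightarrow> (\<lambda>i\<in>{..<n}. cinf_gen E (q i)) \<in> tuples n (carrier (cinf_free E))"
  unfolding restrict_PiE_iff by (auto intro: gen_closed)

lemma free_term_representation:
  assumes "finite J" "\<forall>j\<in>J. a j \<in> carrier (cinf_free E)"
  shows "\<exists>n f q. (\<forall>i<n. q i \<in> E) \<and> (\<forall>j\<in>J. f j \<in> smooth_op n \<and> a j = free_term E n (f j) q)"
proof -
  from free_common_representation[OF assms] obtain E' a' where E': "finite E'" "E' \<subseteq> E"
    and a': "\<forall>j\<in>J. a' j \<in> smooth_fun E'" "\<forall>j\<in>J. \<forall>x\<in>Rpow E. a j x = a' j (restrict x E')"
    by (elim exE conjE) (rule that)
  obtain q where q: "bij_betw q {..<card E'} E'"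
    using ex_bij_betw_nat_finite[OF E'(1)] by (auto simp: lessThan_atLeast0)
  define n where "n = card E'"
  define s where "s = inv_into {..<n} q"
  define f where "f j = (\<lambda>y\<in>Rpow {..<n}. a' j (\<lambda>e\<in>E'. (\<lambda>y\<in>Rpow {..<n}. y (s e)) y))" for j
  have sq: "q (s e) = e" "s e < n" if "e \<in> E'" for e
    using q that bij_betw_inv_into_right[OF q] bij_betwE[OF bij_betw_inv_into[OF q]]
    by (auto simp: s_def n_def)
  have "f j \<in> smooth_op n" if "j \<in> J" for j
    unfolding f_def by (rule smooth_fun_comp[OF E'(1) _ smooth_fun_proj]) (use a'(1) that in blast)
  moreover have "a j = free_term E n (f j) q" if j: "j \<in> J" for j
  proof (rule extensionalityI[of _ "Rpow E"])
    show "a j \<in> extensional (Rpow E)" using assms(2) j by (intro free_extensional) auto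
    show "free_term E n (f j) q \<in> extensional (Rpow E)" by (simp add: free_term_def)
    fix x assume x: "x \<in> Rpow E"
    have "(\<lambda>e\<in>E'. (\<lambda>y\<in>Rpow {..<n}. y (s e)) (\<lambda>i\<in>{..<n}. x (q i))) = restrict x E'"
      by (rule restrict_ext) (simp add: Rpow_restrict sq)
    then have "free_term E n (f j) q x = a' j (restrict x E')"
      using x by (simp only: free_term_def f_def restrict_apply' Rpow_restrict)
    then show "a j x = free_term E n (f j) q x" using a'(2) j x by simp
  qed
  moreover have "\<forall>i<n. q i \<in> E" using bij_betwE[OF q] E'(2) by (auto simp: n_def)
  ultimately show ?thesis by blast
qed

lemma free_hom_unique:
  assumes "h \<in> cinf_hom (cinf_free E) B" "k \<in> cinf_hom (cinf_free E) B"
    and "\<And>e. e \<in> E \<Longrightarrow> h (cinf_gen E e) = k (cinf_gen E e)" and \<phi>: "\<phi> \<in> carrier (cinf_free E)"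
  shows "h \<phi> = k \<phi>"
proof -
  from free_term_representation[of "{0::nat}" "\<lambda>_. \<phi>" E] \<phi> obtain n f q where
    q: "\<forall>i<n. q i \<in> E" and f: "f \<in> smooth_op n" and \<phi>_eq: "\<phi> = free_term E n f q" by auto
  have "(\<lambda>i\<in>{..<n}. h ((\<lambda>i\<in>{..<n}. cinf_gen E (q i)) i)) = (\<lambda>i\<in>{..<n}. k ((\<lambda>i\<in>{..<n}. cinf_gen E (q i)) i))"
    by (rule restrict_ext) (use assms(3) q in auto)
  then show ?thesis
    unfolding \<phi>_eq free_term_eq cinf_homD(2)[OF assms(1) f gen_tuple[OF q]] cinf_homD(2)[OF assms(2) f gen_tuple[OF q]]
    by (simp only:)
qed

context cinf_ring
begin

lemma free_term_eval_unique:
  fixes v :: "'e \<Rightarrow> 'a"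
  assumes v: "\<And>e. e \<in> E \<Longrightarrow> v e \<in> carrier A"
    and f: "f \<in> smooth_op n" "\<forall>i<n. q i \<in> E" and f': "f' \<in> smooth_op n'" "\<forall>i<n'. q' i \<in> E"
    and eq: "free_term E n f q = free_term E n' f' q'"
  shows "interp A n f (\<lambda>i\<in>{..<n}. v (q i)) = interp A n' f' (\<lambda>i\<in>{..<n'}. v (q' i))"
proof -
  define F where "F = q ` {..<n} \<union> q' ` {..<n'}"
  have F: "finite F" "F \<subseteq> E" using f(2) f'(2) by (auto simp: F_def)
  obtain r where r: "bij_betw r {..<card F} F"
    using ex_bij_betw_nat_finite[OF F(1)] by (auto simp: lessThan_atLeast0)
  define m where "m = card F"
  define s where "s = inv_into {..<m} r"
  have s: "r (s e) = e" "s e < m" if "e \<in> F" for e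
    using r that bij_betw_inv_into_right[OF r] bij_betwE[OF bij_betw_inv_into[OF r]]
    by (auto simp: s_def m_def)
  have rE: "r j \<in> E" if "j < m" for j
    using bij_betwE[OF r] F(2) that by (auto simp: m_def)
  define w where "w = (\<lambda>j\<in>{..<m}. v (r j))"
  have w: "w \<in> tuples m (carrier A)"
    unfolding w_def restrict_PiE_iff using v rE by auto
  have main: "interp A m (\<lambda>y\<in>Rpow {..<m}. f (\<lambda>i\<in>{..<n}. (\<lambda>y\<in>Rpow {..<m}. y (s (q i))) y)) w
      = interp A n f (\<lambda>i\<in>{..<n}. v (q i))"
    if f: "f \<in> smooth_op n" and q: "\<forall>i<n. q i \<in> F" for f q n
  proof -
    have "interp A m (\<lambda>y\<in>Rpow {..<m}. f (\<lambda>i\<in>{..<n}. (\<lambda>y\<in>Rpow {..<m}. y (s (q i))) y)) w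
        = interp A n f (\<lambda>i\<in>{..<n}. interp A m (\<lambda>y\<in>Rpow {..<m}. y (s (q i))) w)"
      by (rule interp_comp[OF f smooth_fun_proj w])
    also have "(\<lambda>i\<in>{..<n}. interp A m (\<lambda>y\<in>Rpow {..<m}. y (s (q i))) w) = (\<lambda>i\<in>{..<n}. v (q i))"
    proof (rule restrict_ext)
      fix i assume "i \<in> {..<n}"
      then have "q i \<in> F" using q by simp
      then show "interp A m (\<lambda>y\<in>Rpow {..<m}. y (s (q i))) w = v (q i)"
        using interp_proj[OF s(2) w, of "q i"] s by (simp add: w_def)
    qed
    finally show ?thesis .
  qed
  have "(\<lambda>y\<in>Rpow {..<m}. f (\<lambda>i\<in>{..<n}. (\<lambda>y\<in>Rpow {..<m}. y (s (q i))) y)) =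
        (\<lambda>y\<in>Rpow {..<m}. f' (\<lambda>i\<in>{..<n'}. (\<lambda>y\<in>Rpow {..<m}. y (s (q' i))) y))"
  proof (rule restrict_ext)
    fix y :: "nat \<Rightarrow> real" assume y: "y \<in> Rpow {..<m}"
    define x where "x = (\<lambda>e\<in>E. if e \<in> F then y (s e) else 0)"
    have x: "x \<in> Rpow E" unfolding x_def by (rule Rpow_restrict)
    have e1: "(\<lambda>i\<in>{..<n}. x (q i)) = (\<lambda>i\<in>{..<n}. (\<lambda>y\<in>Rpow {..<m}. y (s (q i))) y)"
      by (rule restrict_ext) (use y f(2) in \<open>auto simp: x_def F_def\<close>)
    have e2: "(\<lambda>i\<in>{..<n'}. x (q' i)) = (\<lambda>i\<in>{..<n'}. (\<lambda>y\<in>Rpow {..<m}. y (s (q' i))) y)"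
      by (rule restrict_ext) (use y f'(2) in \<open>auto simp: x_def F_def\<close>)
    from eq have "free_term E n f q x = free_term E n' f' q' x" by simp
    then show "f (\<lambda>i\<in>{..<n}. (\<lambda>y\<in>Rpow {..<m}. y (s (q i))) y) = f' (\<lambda>i\<in>{..<n'}. (\<lambda>y\<in>Rpow {..<m}. y (s (q' i))) y)"
      using x by (simp only: free_term_def restrict_apply' e1 e2)
  qed
  then show ?thesis
    using main[OF f(1), of q] main[OF f'(1), of q'] by (simp add: F_def)
qed

lemma free_hom_exists:
  fixes v :: "'e \<Rightarrow> 'a"
  assumes v: "\<And>e. e \<in> E \<Longrightarrow> v e \<in> carrier A"
  shows "\<exists>k\<in>cinf_hom (cinf_free E) A. \<forall>e\<in>E. k (cinf_gen E e) = v e"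
proof -
  define k where "k \<phi> = (SOME b. \<exists>n f q. f \<in> smooth_op n \<and> (\<forall>i<n. q i \<in> E) \<and>
     \<phi> = free_term E n f q \<and> b = interp A n f (\<lambda>i\<in>{..<n}. v (q i)))" for \<phi>
  have k: "k (free_term E n f q) = interp A n f (\<lambda>i\<in>{..<n}. v (q i))"
    if f: "f \<in> smooth_op n" "\<forall>i<n. q i \<in> E" for f n q
    unfolding k_def
  proof (rule some_equality)
    show "\<exists>m g r. g \<in> smooth_op m \<and> (\<forall>i<m. r i \<in> E) \<and> free_term E n f q = free_term E m g r \<and>
        interp A n f (\<lambda>i\<in>{..<n}. v (q i)) = interp A m g (\<lambda>i\<in>{..<m}. v (r i))"
      using f by blast
    fix b assume "\<exists>m g r. g \<in> smooth_op m \<and> (\<forall>i<m. r i \<in> E) \<and> free_term E n f q = free_term E m g r \<and>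
        b = interp A m g (\<lambda>i\<in>{..<m}. v (r i))"
    then obtain m g r where g: "g \<in> smooth_op m" "\<forall>i<m. r i \<in> E" "free_term E n f q = free_term E m g r"
        "b = interp A m g (\<lambda>i\<in>{..<m}. v (r i))" by blast
    then show "b = interp A n f (\<lambda>i\<in>{..<n}. v (q i))"
      using free_term_eval_unique[of E v, OF v f g(1,2,3)] by simp
  qed
  have vt: "(\<lambda>i\<in>{..<n}. v (q i)) \<in> tuples n (carrier A)" if "\<forall>i<n. q i \<in> E" for n q
    unfolding restrict_PiE_iff using v that by auto
  have "k \<in> cinf_hom (cinf_free E) A"
    unfolding cinf_hom_def
  proof (intro CollectI conjI allI ballI Pi_I)
    fix \<phi> assume "\<phi> \<in> carrier (cinf_free E)"
    with free_term_representation[of "{0::nat}" "\<lambda>_. \<phi>" E] obtain n f q where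
      q: "\<forall>i<n. q i \<in> E" and f: "f \<in> smooth_op n" and \<phi>_eq: "\<phi> = free_term E n f q" by auto
    show "k \<phi> \<in> carrier A"
      unfolding \<phi>_eq k[OF f q] by (rule interp_closed[OF f vt[OF q]])
  next
    fix n f a assume f: "f \<in> smooth_op n" and a: "a \<in> tuples n (carrier (cinf_free E))"
    have "\<forall>i\<in>{..<n}. a i \<in> carrier (cinf_free E)" by (intro ballI PiE_mem[OF a])
    from free_term_representation[OF finite_lessThan this] obtain m g q where
      q: "\<forall>i<m. q i \<in> E" and g: "\<forall>i\<in>{..<n}. g i \<in> smooth_op m \<and> a i = free_term E m (g i) q"
      by (elim exE conjE) (rule that)
    have g1: "g i \<in> smooth_op m" if "i < n" for i using g that by blast
    have g2: "a i = free_term E m (g i) q" if "i < n" for i using g that by blast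
    have fg: "(\<lambda>x\<in>Rpow {..<m}. f (\<lambda>i\<in>{..<n}. g i x)) \<in> smooth_op m"
      by (rule smooth_fun_comp[OF _ f]) (use g1 in auto)
    have ae: "a = (\<lambda>i\<in>{..<n}. interp (cinf_free E) m (g i) (\<lambda>i\<in>{..<m}. cinf_gen E (q i)))"
      by (rule extensionalityI[of _ "{..<n}"])
        (use a g2 in \<open>auto simp: PiE_def free_term_eq\<close>)
    have "interp (cinf_free E) n f a =
        interp (cinf_free E) n f (\<lambda>i\<in>{..<n}. interp (cinf_free E) m (g i) (\<lambda>i\<in>{..<m}. cinf_gen E (q i)))"
      using ae by (rule arg_cong)
    also have "\<dots> = free_term E m (\<lambda>x\<in>Rpow {..<m}. f (\<lambda>i\<in>{..<n}. g i x)) q"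
      unfolding free_term_eq by (rule cinf_ring.interp_comp[OF cinf_ring_free f g1 gen_tuple[OF q], symmetric])
    finally have "k (interp (cinf_free E) n f a) =
        interp A m (\<lambda>x\<in>Rpow {..<m}. f (\<lambda>i\<in>{..<n}. g i x)) (\<lambda>i\<in>{..<m}. v (q i))"
      by (simp only: k[OF fg q])
    also have "\<dots> = interp A n f (\<lambda>i\<in>{..<n}. interp A m (g i) (\<lambda>i\<in>{..<m}. v (q i)))"
      by (rule interp_comp[OF f g1 vt[OF q]])
    also have "(\<lambda>i\<in>{..<n}. interp A m (g i) (\<lambda>i\<in>{..<m}. v (q i))) = (\<lambda>i\<in>{..<n}. k (a i))"
      by (rule restrict_ext) (simp add: k[OF g1 q] g2)
    finally show "k (interp (cinf_free E) n f a) = interp A n f (\<lambda>i\<in>{..<n}. k (a i))" .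
  qed
  moreover have "k (cinf_gen E e) = v e" if e: "e \<in> E" for e
  proof -
    have "cinf_gen E e = free_term E 1 (\<lambda>y\<in>Rpow {..<1}. y 0) (\<lambda>_. e)"
      unfolding cinf_gen_def free_term_def by (rule restrict_ext) (simp add: Rpow_restrict)
    then have "k (cinf_gen E e) = interp A 1 (\<lambda>y\<in>Rpow {..<1}. y 0) (\<lambda>i\<in>{..<1}. v e)"
      using k[OF smooth_fun_proj, of 1 "\<lambda>_. e" 0] e by simp
    also have "\<dots> = (\<lambda>i\<in>{..<1::nat}. v e) 0"
      by (rule interp_proj) (use v e in auto)
    finally show ?thesis by simp
  qed
  ultimately show ?thesis by blast
qed

lemma quot_hom_exists:
  assumes I: "ideal I (ring_of A)" and B: "cinf_ring B" and h: "h \<in> cinf_hom A B"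
    and hI: "\<And>x. x \<in> I \<Longrightarrow> h x = \<zero>\<^bsub>ring_of B\<^esub>"
  shows "\<exists>k\<in>cinf_hom (cinf_quot A I) B. \<forall>a\<in>carrier A. k (I +>\<^bsub>ring_of A\<^esub> a) = h a"
proof -
  interpret R: cring "ring_of A" by (rule cring_ring_of)
  interpret I: ideal I "ring_of A" by fact
  interpret h: ring_hom_ring "ring_of A" "ring_of B" h
    by (rule cinf_hom_ring_hom_ring[OF cinf_ring_axioms B h])
  define k where "k c = h (SOME a. a \<in> c)" for c
  have k: "k (I +>\<^bsub>ring_of A\<^esub> a) = h a" if a: "a \<in> carrier A" for a
  proof -
    have "a \<in> I +>\<^bsub>ring_of A\<^esub> a" using I.a_rcos_self a by simp
    then have "(SOME b. b \<in> I +>\<^bsub>ring_of A\<^esub> a) \<in> I +>\<^bsub>ring_of A\<^esub> a" by (rule someI)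
    then obtain e where e: "e \<in> I" "(SOME b. b \<in> I +>\<^bsub>ring_of A\<^esub> a) = e \<oplus>\<^bsub>ring_of A\<^esub> a"
      by (auto simp: a_r_coset_def r_coset_def)
    then have "k (I +>\<^bsub>ring_of A\<^esub> a) = h e \<oplus>\<^bsub>ring_of B\<^esub> h a"
      using I.a_Hcarr[OF e(1)] a by (simp add: k_def)
    then show ?thesis using hI[OF e(1)] h.hom_closed[of a] a by simp
  qed
  have "k \<in> cinf_hom (cinf_quot A I) B"
    unfolding cinf_hom_def
  proof (intro CollectI conjI allI ballI Pi_I)
    fix c assume "c \<in> carrier (cinf_quot A I)"
    then show "k c \<in> carrier B" using k cinf_homD(1)[OF h] by (auto simp: quot_carrier)
  next
    fix n f c assume f: "f \<in> smooth_op n" and c: "c \<in> tuples n (carrier (cinf_quot A I))"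
    from quot_tuple_rep[OF c] obtain a where a: "a \<in> tuples n (carrier A)"
      and ca: "c = (\<lambda>i\<in>{..<n}. I +>\<^bsub>ring_of A\<^esub> a i)" .
    have e: "(\<lambda>i\<in>{..<n}. k (c i)) = (\<lambda>i\<in>{..<n}. h (a i))"
      by (rule restrict_ext) (use k PiE_mem[OF a] in \<open>auto simp: ca\<close>)
    show "k (interp (cinf_quot A I) n f c) = interp B n f (\<lambda>i\<in>{..<n}. k (c i))"
      unfolding e unfolding ca interp_quot[OF I f a] k[OF interp_closed[OF f a]] cinf_homD(2)[OF h f a] ..
  qed
  then show ?thesis using k by blast
qed

end


section \<open>Universal property of the localization\<close>

theorem cinf_loc_universal:
  fixes A :: "'a cinf"
  assumes A: "cinf_ring A" and a: "a \<in> carrier A"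
  shows "cinf_ring (cinf_loc A a)"
    and "loc_map A a \<in> cinf_hom A (cinf_loc A a)"
    and "loc_map A a a \<in> Units (ring_of (cinf_loc A a))"
    and "\<And>B h. \<lbrakk>cinf_ring (B :: 'b cinf); h \<in> cinf_hom A B; h a \<in> Units (ring_of B)\<rbrakk> \<Longrightarrow>
      \<exists>!k. k \<in> cinf_hom (cinf_loc A a) B \<and> k \<in> extensional (carrier (cinf_loc A a)) \<and>
        (\<forall>b\<in>carrier A. k (loc_map A a b) = h b)"
proof -
  define F where "F = loc_free A"
  define g where "g = cinf_gen (loc_vars A)"
  define J where "J = loc_ideal A a"
  define L where "L = cinf_loc A a"
  have L: "L = cinf_quot F J" by (simp add: L_def F_def J_def cinf_loc_def)
  have lm: "loc_map A a b = J +>\<^bsub>ring_of F\<^esub> g (Some b)" for b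
    by (simp add: loc_map_def J_def F_def g_def)
  have F: "cinf_ring F" unfolding F_def by (rule cinf_ring_free)
  interpret FR: cring "ring_of F" by (rule cinf_ring.cring_ring_of[OF F])
  have gS: "g (Some b) \<in> carrier F" if "b \<in> carrier A" for b
    unfolding g_def F_def by (rule gen_closed) (use that in simp)
  have gN: "g None \<in> carrier F"
    unfolding g_def F_def by (rule gen_closed) simp
  have gt: "(\<lambda>i\<in>{..<n}. g (Some (b i))) \<in> tuples n (carrier F)" if "b \<in> tuples n (carrier A)" for n b
    unfolding restrict_PiE_iff using gS PiE_mem[OF that] by blast
  have rels: "loc_rels A a =
      {g (Some (interp A n f b)) \<ominus>\<^bsub>ring_of F\<^esub> interp F n f (\<lambda>i\<in>{..<n}. g (Some (b i)))
        | n f b. f \<in> smooth_op n \<and> b \<in> tuples n (carrier A)} \<union>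
      {g (Some a) \<otimes>\<^bsub>ring_of F\<^esub> g None \<ominus>\<^bsub>ring_of F\<^esub> \<one>\<^bsub>ring_of F\<^esub>}"
    by (simp only: loc_rels_def F_def g_def)
  have Ji: "J = Idl\<^bsub>ring_of F\<^esub> (loc_rels A a)" by (simp add: J_def F_def)
  have relmem1: "g (Some (interp A n f b)) \<ominus>\<^bsub>ring_of F\<^esub> interp F n f (\<lambda>i\<in>{..<n}. g (Some (b i))) \<in> loc_rels A a"
    if "f \<in> smooth_op n" "b \<in> tuples n (carrier A)" for n f b
    unfolding rels using that by blast
  have relmem2: "g (Some a) \<otimes>\<^bsub>ring_of F\<^esub> g None \<ominus>\<^bsub>ring_of F\<^esub> \<one>\<^bsub>ring_of F\<^esub> \<in> loc_rels A a"
    unfolding rels by blast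
  have c1: "g (Some (interp A n f b)) \<in> carrier (ring_of F)" "interp F n f (\<lambda>i\<in>{..<n}. g (Some (b i))) \<in> carrier (ring_of F)"
    if "f \<in> smooth_op n" "b \<in> tuples n (carrier A)" for n f b
    using gS cinf_ring.interp_closed[OF A that] cinf_ring.interp_closed[OF F that(1) gt[OF that(2)]] by auto
  have c2: "g (Some a) \<in> carrier (ring_of F)" "g None \<in> carrier (ring_of F)"
    using gS[OF a] gN by auto
  have sub: "loc_rels A a \<subseteq> carrier (ring_of F)"
    unfolding rels using FR.minus_closed[OF c1] FR.minus_closed[OF FR.m_closed[OF c2] FR.one_closed] by auto
  have J: "ideal J (ring_of F)" unfolding Ji by (rule FR.genideal_ideal[OF sub])
  have relJ: "loc_rels A a \<subseteq> J" unfolding Ji by (rule FR.genideal_self[OF sub])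
  define \<pi> where "\<pi> = (\<lambda>x. J +>\<^bsub>ring_of F\<^esub> x)"
  have \<pi>: "\<pi> \<in> cinf_hom F L"
    unfolding \<pi>_def L by (rule cinf_ring.quot_map_hom[OF F J])
  show Lr: "cinf_ring (cinf_loc A a)"
    unfolding L_def[symmetric] L by (rule cinf_ring.cinf_ring_quot[OF F J])
  interpret LR: cring "ring_of L" using cinf_ring.cring_ring_of[OF Lr] by (simp add: L_def)
  interpret p: ring_hom_ring "ring_of F" "ring_of L" \<pi>
    by (rule cinf_hom_ring_hom_ring[OF F _ \<pi>]) (use Lr in \<open>simp add: L_def\<close>)
  have lm\<pi>: "loc_map A a b = \<pi> (g (Some b))" for b by (simp add: lm \<pi>_def)
  have rel1: "\<pi> (g (Some (interp A n f b))) = \<pi> (interp F n f (\<lambda>i\<in>{..<n}. g (Some (b i))))"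
    if "f \<in> smooth_op n" "b \<in> tuples n (carrier A)" for n f b
    using FR.quotient_eq_iff_same_a_r_cos[OF J c1[OF that]] relmem1[OF that] relJ by (auto simp: \<pi>_def)
  have rel2: "\<pi> (g (Some a) \<otimes>\<^bsub>ring_of F\<^esub> g None) = \<pi> \<one>\<^bsub>ring_of F\<^esub>"
    using FR.quotient_eq_iff_same_a_r_cos[OF J FR.m_closed[OF c2] FR.one_closed] relmem2 relJ by (auto simp: \<pi>_def)
  show lmh: "loc_map A a \<in> cinf_hom A (cinf_loc A a)"
    unfolding cinf_hom_def L_def[symmetric]
  proof (intro CollectI conjI allI ballI Pi_I)
    show "loc_map A a b \<in> carrier L" if "b \<in> carrier A" for b
      unfolding lm\<pi> by (rule cinf_homD(1)[OF \<pi> gS[OF that]])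
    fix n f b assume f: "f \<in> smooth_op n" and b: "b \<in> tuples n (carrier A)"
    have "(\<lambda>i\<in>{..<n}. \<pi> ((\<lambda>i\<in>{..<n}. g (Some (b i))) i)) = (\<lambda>i\<in>{..<n}. loc_map A a (b i))"
      by (rule restrict_ext) (simp add: lm\<pi>)
    then show "loc_map A a (interp A n f b) = interp L n f (\<lambda>i\<in>{..<n}. loc_map A a (b i))"
      unfolding lm\<pi>[of "interp A n f b"] rel1[OF f b] cinf_homD(2)[OF \<pi> f gt[OF b]] by (simp only:)
  qed
  have inv: "loc_map A a a \<otimes>\<^bsub>ring_of L\<^esub> \<pi> (g None) = \<one>\<^bsub>ring_of L\<^esub>"
    using rel2 c2 by (simp add: lm\<pi>)
  have cl: "loc_map A a a \<in> carrier (ring_of L)" "\<pi> (g None) \<in> carrier (ring_of L)"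
    using p.hom_closed c2 by (simp_all add: lm\<pi>)
  then show "loc_map A a a \<in> Units (ring_of (cinf_loc A a))"
    unfolding L_def[symmetric] Units_def using inv LR.m_comm[OF cl] by auto
  fix B :: "'b cinf" and h
  assume B: "cinf_ring B" and h: "h \<in> cinf_hom A B" and ha: "h a \<in> Units (ring_of B)"
  interpret BR: cring "ring_of B" by (rule cinf_ring.cring_ring_of[OF B])
  define v where "v e = (case e of None \<Rightarrow> inv\<^bsub>ring_of B\<^esub> (h a) | Some b \<Rightarrow> h b)" for e
  have "v e \<in> carrier B" if "e \<in> loc_vars A" for e
    using that cinf_homD(1)[OF h] BR.Units_inv_closed[OF ha] by (auto simp: v_def)
  from cinf_ring.free_hom_exists[of B "loc_vars A" v, OF B this] obtain k0 where
    k0: "k0 \<in> cinf_hom F B" and k0v: "\<And>e. e \<in> loc_vars A \<Longrightarrow> k0 (g e) = v e"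
    unfolding F_def g_def by blast
  interpret k0: ring_hom_ring "ring_of F" "ring_of B" k0
    by (rule cinf_hom_ring_hom_ring[OF F B k0])
  have k0S: "k0 (g (Some b)) = h b" if "b \<in> carrier A" for b
    using k0v[of "Some b"] that by (simp add: v_def)
  have k0N: "k0 (g None) = inv\<^bsub>ring_of B\<^esub> (h a)"
    using k0v[of None] by (simp add: v_def)
  have zero: "k0 (x \<ominus>\<^bsub>ring_of F\<^esub> y) = \<zero>\<^bsub>ring_of B\<^esub>"
    if "x \<in> carrier (ring_of F)" "y \<in> carrier (ring_of F)" "k0 x = k0 y" for x y
    using that k0.hom_closed[OF that(2)] FR.a_inv_closed[OF that(2)] by (simp add: a_minus_def BR.r_neg)
  have kill1: "k0 (g (Some (interp A n f b))) = k0 (interp F n f (\<lambda>i\<in>{..<n}. g (Some (b i))))"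
    if f: "f \<in> smooth_op n" and b: "b \<in> tuples n (carrier A)" for n f b
  proof -
    have "(\<lambda>i\<in>{..<n}. k0 ((\<lambda>i\<in>{..<n}. g (Some (b i))) i)) = (\<lambda>i\<in>{..<n}. h (b i))"
      by (rule restrict_ext) (use k0S PiE_mem[OF b] in auto)
    then show ?thesis
      unfolding k0S[OF cinf_ring.interp_closed[OF A f b]] cinf_homD(2)[OF k0 f gt[OF b]] cinf_homD(2)[OF h f b]
      by (simp only:)
  qed
  have kill2: "k0 (g (Some a) \<otimes>\<^bsub>ring_of F\<^esub> g None) = k0 \<one>\<^bsub>ring_of F\<^esub>"
    using k0.hom_mult[OF c2] k0S[OF a] k0N BR.Units_r_inv[OF ha] by simp
  have "loc_rels A a \<subseteq> a_kernel (ring_of F) (ring_of B) k0"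
    unfolding rels a_kernel_def'
    using FR.minus_closed[OF c1] FR.minus_closed[OF FR.m_closed[OF c2] FR.one_closed] zero[OF c1 kill1] zero[OF FR.m_closed[OF c2] FR.one_closed kill2] by auto
  from FR.genideal_minimal[OF k0.kernel_is_ideal this]
  have "J \<subseteq> a_kernel (ring_of F) (ring_of B) k0" by (simp only: Ji)
  then have "k0 x = \<zero>\<^bsub>ring_of B\<^esub>" if "x \<in> J" for x
    using that unfolding a_kernel_def' by blast
  from cinf_ring.quot_hom_exists[OF F J B k0 this]
  have "\<exists>k\<in>cinf_hom L B. \<forall>x\<in>carrier F. k (\<pi> x) = k0 x"
    by (simp only: L \<pi>_def)
  then obtain k where
    k: "k \<in> cinf_hom L B" and kk0: "\<And>x. x \<in> carrier F \<Longrightarrow> k (\<pi> x) = k0 x"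
    by blast
  have carL: "carrier L = \<pi> ` carrier F"
    unfolding L \<pi>_def by (rule cinf_ring.quot_carrier[OF F])
  show "\<exists>!k. k \<in> cinf_hom (cinf_loc A a) B \<and> k \<in> extensional (carrier (cinf_loc A a)) \<and>
        (\<forall>b\<in>carrier A. k (loc_map A a b) = h b)"
    unfolding L_def[symmetric]
  proof (rule ex_ex1I)
    show "\<exists>k. k \<in> cinf_hom L B \<and> k \<in> extensional (carrier L) \<and> (\<forall>b\<in>carrier A. k (loc_map A a b) = h b)"
    proof (intro exI conjI ballI)
      show "restrict k (carrier L) \<in> cinf_hom L B"
        by (rule cinf_hom_cong[OF k]) (use Lr in \<open>simp_all add: L_def\<close>)
      show "restrict k (carrier L) \<in> extensional (carrier L)" by simp
      show "restrict k (carrier L) (loc_map A a b) = h b" if b: "b \<in> carrier A" for b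
        using kk0[OF gS[OF b]] k0S[OF b] cinf_homD(1)[OF \<pi> gS[OF b]] by (simp add: lm\<pi>)
    qed
  next
    fix k k'
    assume k: "k \<in> cinf_hom L B \<and> k \<in> extensional (carrier L) \<and> (\<forall>b\<in>carrier A. k (loc_map A a b) = h b)"
      and k': "k' \<in> cinf_hom L B \<and> k' \<in> extensional (carrier L) \<and> (\<forall>b\<in>carrier A. k' (loc_map A a b) = h b)"
    have inverse: "k (\<pi> (g None)) = inv\<^bsub>ring_of B\<^esub> (h a)" if k: "k \<in> cinf_hom L B" "k (loc_map A a a) = h a" for k
    proof -
      interpret k: ring_hom_ring "ring_of L" "ring_of B" k
        by (rule cinf_hom_ring_hom_ring[OF _ B k(1)]) (use Lr in \<open>simp add: L_def\<close>)
      have "h a \<otimes>\<^bsub>ring_of B\<^esub> k (\<pi> (g None)) = \<one>\<^bsub>ring_of B\<^esub>"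
        using k.hom_mult[OF cl] inv k(2) by simp
      then show ?thesis
        using BR.inv_unique[OF BR.Units_l_inv[OF ha], of "k (\<pi> (g None))"] BR.Units_closed[OF ha]
          BR.Units_inv_closed[OF ha] k.hom_closed[OF cl(2)] by simp
    qed
    have comp: "(\<lambda>x. k (\<pi> x)) \<in> cinf_hom F B" "(\<lambda>x. k' (\<pi> x)) \<in> cinf_hom F B"
      using cinf_hom_comp[OF \<pi>] k k' by blast+
    have "k (\<pi> (g e)) = k' (\<pi> (g e))" if "e \<in> loc_vars A" for e
      using that k k' inverse[of k] inverse[of k'] a by (auto simp: lm\<pi>)
    then have "k (\<pi> x) = k' (\<pi> x)" if "x \<in> carrier F" for x
      using free_hom_unique[OF comp[unfolded F_def]] that by (simp add: F_def g_def)
    then have "k y = k' y" if "y \<in> carrier L" for y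
      using that by (auto simp: carL)
    then show "k = k'" using k k' extensionalityI by metis
  qed
qed

end

(* If h > 0 on the zero set of \<phi>, then h^2 + \<phi>^2 and r + h, where r = sqrt (h^2 + \<phi>^2), are positive
   everywhere, so r and 1 / (r + h) are smooth.  From (r + h) (r - h) = \<phi>^2 one gets that r and h
   are congruent modulo every ideal containing \<phi>, and r is the square of an everywhere positive
   smooth function.  Apply this to h = g - f.  Conversely, if h k - 1 and (g - f) - h^2 lie in I,
   then so does the sum of their squares, and on its zero set g - f = h^2 > 0. *)

theory Submission
  imports Defs
begin

section \<open>Real powers of positive smooth functions\<close>

text \<open>The exponent is generalized in the induction because each partial derivative of the
  power contains \<open>p\<close> to the exponent \<open>a - 1\<close>. Allowing every real exponent
  lets one lemma supply the square roots, the reciprocal and the reciprocal root needed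
  below.\<close>

lemma Ck_powr:
  assumes "Ck k S p" "\<And>x. x \<in> Rpow S \<Longrightarrow> p x > 0"
  shows "Ck k S (\<lambda>x. p x powr a)"
  using assms
proof (induction k arbitrary: a)
  case 0
  then show ?case by (force intro!: continuous_intros)
next
  case (Suc k)
  show ?case
  proof (rule Ck_SucI[where D = "\<lambda>i x. a * p x powr (a - 1) * partial_deriv i p x"])
    show "continuous_on (Rpow S) (\<lambda>x. p x powr a)"
      using Ck_continuous[OF Suc.prems(1)] Suc.prems(2) by (force intro!: continuous_intros)
    show "Ck k S (\<lambda>x. a * p x powr (a - 1) * partial_deriv i p x)" if "i \<in> S" for i
      by (intro Ck_mult Ck_const Suc.IH Ck_SucD[OF Suc.prems(1)] Suc.prems(2)
          Ck_partial_deriv[OF Suc.prems(1) that])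
    fix i x assume i: "i \<in> S" and x: "x \<in> Rpow S"
    \<comment> \<open>The base point is written \<open>p (x(i := x i))\<close> so that it matches
      the inner function \<open>\<lambda>t. p (x(i := t))\<close> at \<open>x i\<close> in the chain
      rule.\<close>
    have "((\<lambda>y. y powr a) has_real_derivative a * p x powr (a - 1)) (at (p (x(i := x i))))"
      using has_real_derivative_powr[OF Suc.prems(2)[OF x], of a] by simp
    from DERIV_chain2[OF this Ck_has_partial0[OF Suc.prems(1) i x]]
    show "((\<lambda>t. p (x(i := t)) powr a) has_real_derivative
        a * p x powr (a - 1) * partial_deriv i p x) (at (x i))" .
  qed
qed

text \<open>Smoothness in the free ring is that of a representative in finitely many variables, so
  positivity must first pass from \<open>p\<close> to this representative; \<open>Ck_powr\<close>
  then applies.\<close>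

lemma free_powr_closed:
  assumes p: "p \<in> carrier (cinf_free E)" and pos: "\<And>x. x \<in> Rpow E \<Longrightarrow> p x > 0"
  shows "(\<lambda>x\<in>Rpow E. p x powr a) \<in> carrier (cinf_free E)"
proof -
  from p obtain E' p' where E': "finite E'" "E' \<subseteq> E" and p': "p' \<in> smooth_fun E'"
    and pp': "\<And>x. x \<in> Rpow E \<Longrightarrow> p x = p' (restrict x E')"
    by (auto simp: cinf_free_def)
  have pos': "p' y > 0" if y: "y \<in> Rpow E'" for y
  proof -
    \<comment> \<open>Extension by zero: every point of \<open>Rpow E'\<close> is the restriction of
      a point of \<open>Rpow E\<close>, so \<open>p'\<close> takes no values other than those of
      \<open>p\<close>.\<close>
    define x where "x = (\<lambda>e\<in>E. if e \<in> E' then y e else 0)"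
    have "x \<in> Rpow E" unfolding x_def by (rule Rpow_restrict)
    moreover have "restrict x E' = y"
      using y E'(2) by (auto simp: x_def Rpow_def PiE_def extensional_def fun_eq_iff)
    ultimately show ?thesis using pos pp' by metis
  qed
  show ?thesis
  proof (rule free_carrierI[OF E'])
    show "(\<lambda>y\<in>Rpow E'. p' y powr a) \<in> smooth_fun E'"
      by (intro smooth_funI Ck_powr smooth_fun_Ck[OF p'] pos')
  qed (simp_all add: pp' Rpow_restrict)
qed

section \<open>Ring operations of the free smooth ring, computed pointwise\<close>

lemma free_add: "p \<oplus>\<^bsub>ring_of (cinf_free E)\<^esub> q = (\<lambda>x\<in>Rpow E. p x + q x)"
proof -
  \<comment> \<open>The binary operation is extensional on \<open>Rpow {..<2}\<close>, so it
    evaluates to a sum only at a tuple known to lie there.\<close>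
  have "(\<lambda>i\<in>{..<2}. pair p q i x) \<in> Rpow {..<2}" for x by (rule Rpow_restrict)
  then show ?thesis by (simp add: ring_of_def free_interp pair_def)
qed

lemma free_mult: "p \<otimes>\<^bsub>ring_of (cinf_free E)\<^esub> q = (\<lambda>x\<in>Rpow E. p x * q x)"
proof -
  have "(\<lambda>i\<in>{..<2}. pair p q i x) \<in> Rpow {..<2}" for x by (rule Rpow_restrict)
  then show ?thesis by (simp add: ring_of_def free_interp pair_def)
qed

lemma free_zero: "\<zero>\<^bsub>ring_of (cinf_free E)\<^esub> = (\<lambda>x\<in>Rpow E. 0)"
  by (simp only: ring_of_def free_interp ring.simps restrict_apply'[OF Rpow_restrict])

lemma free_one: "\<one>\<^bsub>ring_of (cinf_free E)\<^esub> = (\<lambda>x\<in>Rpow E. 1)"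
  by (simp only: ring_of_def free_interp monoid.simps restrict_apply'[OF Rpow_restrict])

text \<open>The additive inverse is given by a description, not by an operation that unfolds
  pointwise. Its values are read off from the equation that \<open>q\<close> plus its inverse is
  zero, which requires \<open>q\<close> to be in the carrier.\<close>

lemma free_minus:
  assumes "p \<in> carrier (cinf_free E)" "q \<in> carrier (cinf_free E)"
  shows "p \<ominus>\<^bsub>ring_of (cinf_free E)\<^esub> q = (\<lambda>x\<in>Rpow E. p x - q x)"
proof -
  interpret R: cring "ring_of (cinf_free E)" by (rule cinf_ring.cring_ring_of[OF cinf_ring_free])
  have "q \<oplus>\<^bsub>ring_of (cinf_free E)\<^esub> (\<ominus>\<^bsub>ring_of (cinf_free E)\<^esub> q) = \<zero>\<^bsub>ring_of (cinf_free E)\<^esub>"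
    using assms R.r_neg by simp
  then have "q x + (\<ominus>\<^bsub>ring_of (cinf_free E)\<^esub> q) x = 0" if "x \<in> Rpow E" for x
    using that unfolding free_add free_zero by (auto dest: fun_cong[of _ _ x])
  then have "(\<ominus>\<^bsub>ring_of (cinf_free E)\<^esub> q) x = - q x" if "x \<in> Rpow E" for x
    using that by (metis add_eq_0_iff)
  then show ?thesis
    unfolding a_minus_def free_add by (intro restrict_ext) simp
qed

section \<open>Positivity on zero sets versus unit squares modulo an ideal\<close>

text \<open>The last two hypotheses say on representatives that \<open>u\<close> is a unit modulo
  \<open>I\<close>, with inverse \<open>v\<close>, and that its square is \<open>d\<close> modulo
  \<open>I\<close>.\<close>

lemma positive_on_zero_set_of_square_mod_ideal:
  assumes I: "ideal I (ring_of (cinf_free E))"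
    and d: "d \<in> carrier (cinf_free E)" and u: "u \<in> carrier (cinf_free E)"
    and v: "v \<in> carrier (cinf_free E)"
    and uv: "u \<otimes>\<^bsub>ring_of (cinf_free E)\<^esub> v \<ominus>\<^bsub>ring_of (cinf_free E)\<^esub> \<one>\<^bsub>ring_of (cinf_free E)\<^esub> \<in> I"
    and du: "d \<ominus>\<^bsub>ring_of (cinf_free E)\<^esub> u \<otimes>\<^bsub>ring_of (cinf_free E)\<^esub> u \<in> I"
  obtains \<phi> where "\<phi> \<in> I" "\<And>x. x \<in> zero_set E \<phi> \<Longrightarrow> 0 < d x"
proof -
  interpret R: cring "ring_of (cinf_free E)" by (rule cinf_ring.cring_ring_of[OF cinf_ring_free])
  interpret I: ideal I "ring_of (cinf_free E)" by fact
  define s where "s = u \<otimes>\<^bsub>ring_of (cinf_free E)\<^esub> v \<ominus>\<^bsub>ring_of (cinf_free E)\<^esub> \<one>\<^bsub>ring_of (cinf_free E)\<^esub>"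
  define t where "t = d \<ominus>\<^bsub>ring_of (cinf_free E)\<^esub> u \<otimes>\<^bsub>ring_of (cinf_free E)\<^esub> u"
  \<comment> \<open>Over the reals a sum of squares merges two equations into one, so a single
    element of \<open>I\<close> enforces both relations.\<close>
  define \<phi> where "\<phi> = s \<otimes>\<^bsub>ring_of (cinf_free E)\<^esub> s \<oplus>\<^bsub>ring_of (cinf_free E)\<^esub> t \<otimes>\<^bsub>ring_of (cinf_free E)\<^esub> t"
  have st: "s \<in> I" "t \<in> I" using uv du by (simp_all add: s_def t_def)
  have sx: "s x = u x * v x - 1" and tx: "t x = d x - u x * u x" if "x \<in> Rpow E" for x
    unfolding s_def t_def
    using that R.m_closed[of u v] R.m_closed[of u u] R.one_closed d u v
    by (simp_all add: free_minus free_mult free_one)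
  show ?thesis
  proof
    show "\<phi> \<in> I"
      unfolding \<phi>_def using st by (intro I.a_closed I.I_l_closed I.a_Hcarr)
    fix x assume "x \<in> zero_set E \<phi>"
    then have x: "x \<in> Rpow E" and "s x * s x + t x * t x = 0"
      by (auto simp: zero_set_def \<phi>_def free_add free_mult)
    then have "s x = 0" "t x = 0" by simp_all
    then have "u x * v x = 1" "d x = u x * u x" using sx[OF x] tx[OF x] by simp_all
    moreover from this have "u x \<noteq> 0" by auto
    ultimately show "0 < d x" by (simp add: power2_eq_square[symmetric])
  qed
qed

text \<open>The unit found here is invertible in the free ring itself, not merely modulo
  \<open>I\<close>; its square is a smooth positive function that differs from \<open>h\<close> by a
  multiple of \<open>\<phi>\<close>.\<close>

lemma square_mod_ideal_of_positive_on_zero_set: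
  assumes I: "ideal I (ring_of (cinf_free E))" and \<phi>: "\<phi> \<in> I"
    and h: "h \<in> carrier (cinf_free E)" and pos: "\<And>x. x \<in> zero_set E \<phi> \<Longrightarrow> 0 < h x"
  obtains u v where "u \<in> carrier (cinf_free E)" "v \<in> carrier (cinf_free E)"
    "u \<otimes>\<^bsub>ring_of (cinf_free E)\<^esub> v = \<one>\<^bsub>ring_of (cinf_free E)\<^esub>"
    "u \<otimes>\<^bsub>ring_of (cinf_free E)\<^esub> u \<ominus>\<^bsub>ring_of (cinf_free E)\<^esub> h \<in> I"
proof -
  interpret R: cring "ring_of (cinf_free E)" by (rule cinf_ring.cring_ring_of[OF cinf_ring_free])
  interpret I: ideal I "ring_of (cinf_free E)" by fact
  have \<phi>c: "\<phi> \<in> carrier (cinf_free E)" using I.a_Hcarr[OF \<phi>] by simp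
  define q where "q = h \<otimes>\<^bsub>ring_of (cinf_free E)\<^esub> h \<oplus>\<^bsub>ring_of (cinf_free E)\<^esub> \<phi> \<otimes>\<^bsub>ring_of (cinf_free E)\<^esub> \<phi>"
  have qc: "q \<in> carrier (cinf_free E)"
    using R.a_closed[of "h \<otimes>\<^bsub>ring_of (cinf_free E)\<^esub> h" "\<phi> \<otimes>\<^bsub>ring_of (cinf_free E)\<^esub> \<phi>"]
      R.m_closed[of h h] R.m_closed[of \<phi> \<phi>] h \<phi>c by (simp add: q_def)
  have qx: "q x = (h x)\<^sup>2 + (\<phi> x)\<^sup>2" if "x \<in> Rpow E" for x
    using that by (simp add: q_def free_add free_mult power2_eq_square)
  have q0: "q x > 0" if x: "x \<in> Rpow E" for x
  proof (cases "\<phi> x = 0")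
    case True
    then have "h x > 0" using pos x by (simp add: zero_set_def)
    then show ?thesis by (simp add: qx[OF x] add_pos_nonneg)
  next
    case False
    then show ?thesis by (simp add: qx[OF x] add_nonneg_pos)
  qed
  define r where "r = (\<lambda>x\<in>Rpow E. q x powr (1/2))"
  have rc: "r \<in> carrier (cinf_free E)" unfolding r_def by (rule free_powr_closed[OF qc q0])
  have r0: "r x > 0" and r2: "(r x)\<^sup>2 = (h x)\<^sup>2 + (\<phi> x)\<^sup>2" if x: "x \<in> Rpow E" for x
    using q0[OF x] x by (simp_all add: r_def powr_half_sqrt qx[symmetric])
  define w where "w = r \<oplus>\<^bsub>ring_of (cinf_free E)\<^esub> h"
  have wc: "w \<in> carrier (cinf_free E)" using R.a_closed[of r h] rc h by (simp add: w_def)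
  have w0: "w x > 0" if x: "x \<in> Rpow E" for x
  proof (cases "\<phi> x = 0")
    case True
    then have "h x > 0" using pos x by (simp add: zero_set_def)
    then show ?thesis using r0[OF x] x by (simp add: w_def free_add)
  next
    case False
    \<comment> \<open>Here \<open>h x\<close> may be negative, but the nonzero
      \<open>\<phi> x\<close> makes \<open>r x\<close> strictly larger than its absolute
      value.\<close>
    then have "\<bar>h x\<bar>\<^sup>2 < (r x)\<^sup>2" using r2[OF x] by simp
    then have "\<bar>h x\<bar> < r x" using r0[OF x] power_less_imp_less_base[of "\<bar>h x\<bar>" 2 "r x"] by simp
    then show ?thesis using x by (simp add: w_def free_add)
  qed
  \<comment> \<open>The reciprocal of \<open>r + h\<close>; it is the cofactor that turns the square
    of \<open>\<phi>\<close> into \<open>r - h\<close>.\<close>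
  define z where "z = (\<lambda>x\<in>Rpow E. w x powr (-1))"
  have zc: "z \<in> carrier (cinf_free E)" unfolding z_def by (rule free_powr_closed[OF wc w0])
  define u where "u = (\<lambda>x\<in>Rpow E. r x powr (1/2))"
  define v where "v = (\<lambda>x\<in>Rpow E. r x powr (-1/2))"
  have uc: "u \<in> carrier (cinf_free E)" unfolding u_def by (rule free_powr_closed[OF rc r0])
  have vc: "v \<in> carrier (cinf_free E)" unfolding v_def by (rule free_powr_closed[OF rc r0])
  have uv: "u \<otimes>\<^bsub>ring_of (cinf_free E)\<^esub> v = \<one>\<^bsub>ring_of (cinf_free E)\<^esub>"
    unfolding free_mult free_one
  proof (rule restrict_ext)
    fix x assume x: "x \<in> Rpow E"
    \<comment> \<open>The exponents cancel; \<open>r x powr 0\<close> equals 1 because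
      \<open>r x\<close> is nonzero.\<close>
    show "u x * v x = 1" using x r0[OF x] by (simp add: u_def v_def powr_add[symmetric])
  qed
  have uuc: "u \<otimes>\<^bsub>ring_of (cinf_free E)\<^esub> u \<in> carrier (cinf_free E)"
    using R.m_closed[of u u] uc by simp
  have dI: "\<phi> \<otimes>\<^bsub>ring_of (cinf_free E)\<^esub> (\<phi> \<otimes>\<^bsub>ring_of (cinf_free E)\<^esub> z) \<in> I"
    using I.I_r_closed[OF \<phi>, of "\<phi> \<otimes>\<^bsub>ring_of (cinf_free E)\<^esub> z"] R.m_closed[of \<phi> z] \<phi>c zc by simp
  have "u \<otimes>\<^bsub>ring_of (cinf_free E)\<^esub> u \<ominus>\<^bsub>ring_of (cinf_free E)\<^esub> h =
      \<phi> \<otimes>\<^bsub>ring_of (cinf_free E)\<^esub> (\<phi> \<otimes>\<^bsub>ring_of (cinf_free E)\<^esub> z)"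
    unfolding free_minus[OF uuc h] unfolding free_mult
  proof (rule restrict_ext)
    fix x assume x: "x \<in> Rpow E"
    have "u x * u x = r x" using x r0[OF x] by (simp add: u_def powr_add[symmetric])
    moreover have z: "z x = 1 / (r x + h x)"
      using x w0[OF x] by (simp add: z_def w_def free_add powr_minus divide_inverse)
    moreover have "r x + h x > 0" using w0[OF x] x by (simp add: w_def free_add)
    moreover have "(r x - h x) * (r x + h x) = \<phi> x * \<phi> x"
      using r2[OF x] by (simp add: algebra_simps power2_eq_square)
    ultimately have "u x * u x - h x = \<phi> x * \<phi> x / (r x + h x)"
      by (simp add: nonzero_eq_divide_eq)
    then have "u x * u x - h x = \<phi> x * (\<phi> x * z x)" by (simp add: z)
    then show "(\<lambda>x\<in>Rpow E. u x * u x) x - h x = \<phi> x * (\<lambda>x\<in>Rpow E. \<phi> x * z x) x"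
      using x by simp
  qed
  then show ?thesis using that[OF uc vc uv] dI by simp
qed

section \<open>The canonical relation of a quotient, expressed by representatives\<close>

text \<open>Being a unit and being its square are equations between cosets, and two cosets agree
  exactly when the difference of representatives is in \<open>I\<close>. Surjectivity of the
  quotient map lets the quantifiers range over \<open>A\<close>.\<close>

lemma (in cinf_ring) canon_rel_quot_iff:
  assumes I: "ideal I (ring_of A)" and f: "f \<in> carrier A" and g: "g \<in> carrier A"
  shows "canon_rel (cinf_quot A I) (I +>\<^bsub>ring_of A\<^esub> f) (I +>\<^bsub>ring_of A\<^esub> g) \<longleftrightarrow>
    (\<exists>u\<in>carrier A. \<exists>v\<in>carrier A. u \<otimes>\<^bsub>ring_of A\<^esub> v \<ominus>\<^bsub>ring_of A\<^esub> \<one>\<^bsub>ring_of A\<^esub> \<in> I \<and>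
      (g \<ominus>\<^bsub>ring_of A\<^esub> f) \<ominus>\<^bsub>ring_of A\<^esub> u \<otimes>\<^bsub>ring_of A\<^esub> u \<in> I)"
proof -
  define \<pi> where "\<pi> = (\<lambda>a. I +>\<^bsub>ring_of A\<^esub> a)"
  define Q where "Q = cinf_quot A I"
  interpret R: cring "ring_of A" by (rule cring_ring_of)
  interpret I: ideal I "ring_of A" by fact
  have Q: "cinf_ring Q" unfolding Q_def by (rule cinf_ring_quot[OF I])
  interpret Q: cring "ring_of Q" by (rule cinf_ring.cring_ring_of[OF Q])
  interpret p: ring_hom_ring "ring_of A" "ring_of Q" \<pi>
    unfolding \<pi>_def Q_def
    by (rule cinf_hom_ring_hom_ring[OF cinf_ring_axioms cinf_ring_quot[OF I] quot_map_hom[OF I]])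
  have eq: "\<pi> a = \<pi> b \<longleftrightarrow> a \<ominus>\<^bsub>ring_of A\<^esub> b \<in> I" if "a \<in> carrier A" "b \<in> carrier A" for a b
    unfolding \<pi>_def using R.quotient_eq_iff_same_a_r_cos[OF I, of a b] that by auto
  have car: "carrier Q = \<pi> ` carrier A" unfolding Q_def \<pi>_def by (rule quot_carrier)
  have cl: "a \<otimes>\<^bsub>ring_of A\<^esub> b \<in> carrier A" if "a \<in> carrier A" "b \<in> carrier A" for a b
    using R.m_closed[of a b] that by simp
  have one: "\<one>\<^bsub>ring_of A\<^esub> \<in> carrier A" using R.one_closed by simp
  have gf: "g \<ominus>\<^bsub>ring_of A\<^esub> f \<in> carrier A" using R.minus_closed[of g f] f g by simp
  have unit: "\<pi> u \<in> Units (ring_of Q) \<longleftrightarrow>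
      (\<exists>v\<in>carrier A. u \<otimes>\<^bsub>ring_of A\<^esub> v \<ominus>\<^bsub>ring_of A\<^esub> \<one>\<^bsub>ring_of A\<^esub> \<in> I)" if u: "u \<in> carrier A" for u
  proof -
    have "\<pi> u \<in> carrier (ring_of Q)" using u by (simp add: car)
    \<comment> \<open>\<open>Units\<close> asks for a two-sided inverse; commutativity reduces this
      to one equation.\<close>
    then have "\<pi> u \<in> Units (ring_of Q) \<longleftrightarrow>
        (\<exists>y\<in>carrier Q. \<pi> u \<otimes>\<^bsub>ring_of Q\<^esub> y = \<one>\<^bsub>ring_of Q\<^esub>)"
      using Q.m_comm[of "\<pi> u"] by (auto simp: Units_def)
    also have "\<dots> \<longleftrightarrow> (\<exists>v\<in>carrier A. \<pi> (u \<otimes>\<^bsub>ring_of A\<^esub> v) = \<pi> \<one>\<^bsub>ring_of A\<^esub>)"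
      using u by (simp add: car)
    finally show ?thesis using eq[OF cl[OF u] one] by auto
  qed
  have "\<pi> (g \<ominus>\<^bsub>ring_of A\<^esub> f) = \<pi> g \<ominus>\<^bsub>ring_of Q\<^esub> \<pi> f"
    using f g p.hom_add[of g "\<ominus>\<^bsub>ring_of A\<^esub> f"] p.hom_a_inv[of f] R.a_inv_closed[of f]
    by (simp add: a_minus_def)
  moreover have "\<pi> (u \<otimes>\<^bsub>ring_of A\<^esub> u) = \<pi> u [^]\<^bsub>ring_of Q\<^esub> (2::nat)" if "u \<in> carrier A" for u
    using p.hom_closed[of u] that by (simp add: numeral_2_eq_2)
  ultimately have square: "\<pi> g \<ominus>\<^bsub>ring_of Q\<^esub> \<pi> f = \<pi> u [^]\<^bsub>ring_of Q\<^esub> (2::nat) \<longleftrightarrow>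
      (g \<ominus>\<^bsub>ring_of A\<^esub> f) \<ominus>\<^bsub>ring_of A\<^esub> u \<otimes>\<^bsub>ring_of A\<^esub> u \<in> I" if "u \<in> carrier A" for u
    using eq[OF gf cl[OF that that]] that by simp
  have "canon_rel Q (\<pi> f) (\<pi> g) \<longleftrightarrow>
      (\<exists>u\<in>carrier A. \<pi> u \<in> Units (ring_of Q) \<and> \<pi> g \<ominus>\<^bsub>ring_of Q\<^esub> \<pi> f = \<pi> u [^]\<^bsub>ring_of Q\<^esub> (2::nat))"
  proof
    assume "canon_rel Q (\<pi> f) (\<pi> g)"
    then obtain y where y: "y \<in> Units (ring_of Q)"
        "\<pi> g \<ominus>\<^bsub>ring_of Q\<^esub> \<pi> f = y [^]\<^bsub>ring_of Q\<^esub> (2::nat)"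
      unfolding canon_rel_def by (rule bexE)
    moreover obtain u where "u \<in> carrier A" "y = \<pi> u"
      using Q.Units_closed[OF y(1)] unfolding ring_of_carrier car by (rule imageE)
    ultimately show "\<exists>u\<in>carrier A. \<pi> u \<in> Units (ring_of Q) \<and>
        \<pi> g \<ominus>\<^bsub>ring_of Q\<^esub> \<pi> f = \<pi> u [^]\<^bsub>ring_of Q\<^esub> (2::nat)"
      by (intro bexI[of _ u]) simp_all
  qed (auto simp: canon_rel_def)
  also have "\<dots> \<longleftrightarrow> (\<exists>u\<in>carrier A. \<exists>v\<in>carrier A. u \<otimes>\<^bsub>ring_of A\<^esub> v \<ominus>\<^bsub>ring_of A\<^esub> \<one>\<^bsub>ring_of A\<^esub> \<in> I \<and>
      (g \<ominus>\<^bsub>ring_of A\<^esub> f) \<ominus>\<^bsub>ring_of A\<^esub> u \<otimes>\<^bsub>ring_of A\<^esub> u \<in> I)"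
    using unit square by (metis (no_types, lifting))
  finally show ?thesis by (simp only: Q_def \<pi>_def)
qed

theorem theorem3p7:
  fixes E :: "'e set" and I :: "(('e \<Rightarrow> real) \<Rightarrow> real) set"
  assumes "ideal I (ring_of (cinf_free E))"
    and "cinf_reduced (cinf_quot (cinf_free E) I)"
  shows "\<forall>f \<in> carrier (cinf_free E). \<forall>g \<in> carrier (cinf_free E).
    canon_rel (cinf_quot (cinf_free E) I)
        (I +>\<^bsub>ring_of (cinf_free E)\<^esub> f) (I +>\<^bsub>ring_of (cinf_free E)\<^esub> g) \<longleftrightarrow>
      (\<exists>\<phi>\<in>I. \<forall>x\<in>zero_set E \<phi>. f x < g x)"
proof (intro ballI)
  fix f g assume f: "f \<in> carrier (cinf_free E)" and g: "g \<in> carrier (cinf_free E)"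
  note I = assms(1)
  interpret R: cring "ring_of (cinf_free E)" by (rule cinf_ring.cring_ring_of[OF cinf_ring_free])
  interpret I: ideal I "ring_of (cinf_free E)" by fact
  define d where "d = g \<ominus>\<^bsub>ring_of (cinf_free E)\<^esub> f"
  have d: "d \<in> carrier (cinf_free E)" using R.minus_closed[of g f] f g by (simp add: d_def)
  have dx: "0 < d x \<longleftrightarrow> f x < g x" if "x \<in> zero_set E \<phi>" for x \<phi>
    using that by (simp add: d_def free_minus[OF g f] zero_set_def)
  have "(\<exists>u\<in>carrier (cinf_free E). \<exists>v\<in>carrier (cinf_free E).
      u \<otimes>\<^bsub>ring_of (cinf_free E)\<^esub> v \<ominus>\<^bsub>ring_of (cinf_free E)\<^esub> \<one>\<^bsub>ring_of (cinf_free E)\<^esub> \<in> I \<and>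
      d \<ominus>\<^bsub>ring_of (cinf_free E)\<^esub> u \<otimes>\<^bsub>ring_of (cinf_free E)\<^esub> u \<in> I) \<longleftrightarrow>
    (\<exists>\<phi>\<in>I. \<forall>x\<in>zero_set E \<phi>. 0 < d x)" (is "?L \<longleftrightarrow> ?R")
  proof
    assume ?L
    then show ?R using positive_on_zero_set_of_square_mod_ideal[OF I d] by metis
  next
    assume ?R
    then obtain \<phi> where \<phi>: "\<phi> \<in> I" "\<And>x. x \<in> zero_set E \<phi> \<Longrightarrow> 0 < d x" by blast
    from square_mod_ideal_of_positive_on_zero_set[OF I \<phi>(1) d \<phi>(2)] obtain u v where
      u: "u \<in> carrier (cinf_free E)" and v: "v \<in> carrier (cinf_free E)"
      and uv: "u \<otimes>\<^bsub>ring_of (cinf_free E)\<^esub> v = \<one>\<^bsub>ring_of (cinf_free E)\<^esub>"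
      and ud: "u \<otimes>\<^bsub>ring_of (cinf_free E)\<^esub> u \<ominus>\<^bsub>ring_of (cinf_free E)\<^esub> d \<in> I"
      by metis
    \<comment> \<open>The inverse is exact, so this difference is zero.\<close>
    have "u \<otimes>\<^bsub>ring_of (cinf_free E)\<^esub> v \<ominus>\<^bsub>ring_of (cinf_free E)\<^esub> \<one>\<^bsub>ring_of (cinf_free E)\<^esub> \<in> I"
      unfolding uv a_minus_def using R.r_neg[OF R.one_closed] I.zero_closed by simp
    moreover have "d \<ominus>\<^bsub>ring_of (cinf_free E)\<^esub> u \<otimes>\<^bsub>ring_of (cinf_free E)\<^esub> u \<in> I"
    proof -
      have uu: "u \<otimes>\<^bsub>ring_of (cinf_free E)\<^esub> u \<in> carrier (ring_of (cinf_free E))"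
        using R.m_closed[of u u] u by simp
      have d': "d \<in> carrier (ring_of (cinf_free E))" using d by simp
      \<comment> \<open>\<open>ud\<close> has the opposite sign, and ideals are closed under
        negation.\<close>
      have "d \<ominus>\<^bsub>ring_of (cinf_free E)\<^esub> u \<otimes>\<^bsub>ring_of (cinf_free E)\<^esub> u =
          \<ominus>\<^bsub>ring_of (cinf_free E)\<^esub> (u \<otimes>\<^bsub>ring_of (cinf_free E)\<^esub> u \<ominus>\<^bsub>ring_of (cinf_free E)\<^esub> d)"
        using uu d' by (simp add: a_minus_def R.minus_add R.a_comm del: ring_of_carrier)
      then show ?thesis using I.a_inv_closed[OF ud] by simp
    qed
    ultimately show ?L using u v by blast
  qed
  moreover have "?R \<longleftrightarrow> (\<exists>\<phi>\<in>I. \<forall>x\<in>zero_set E \<phi>. f x < g x)" using dx by blast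
  ultimately show "canon_rel (cinf_quot (cinf_free E) I)
        (I +>\<^bsub>ring_of (cinf_free E)\<^esub> f) (I +>\<^bsub>ring_of (cinf_free E)\<^esub> g) \<longleftrightarrow>
      (\<exists>\<phi>\<in>I. \<forall>x\<in>zero_set E \<phi>. f x < g x)"
    using cinf_ring.canon_rel_quot_iff[OF cinf_ring_free I f g] by (simp add: d_def)
qed

end
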